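(* Let $\mu\ge 2$ and $d\ge2$ be integers, $m=\mu^d$, $\alpha=1/d$, and let $$W_\nabla=\big\{g\in V\otimes\mathbb{C}^d:\ \exists f\colon(\mathbb{Z}_\mu)^d\to\mathbb{C}\ \text{ such that }\ g_j(x)=f(x+e_j)-f(x)\ \ \forall x\in(\mathbb{Z}_\mu)^d,\ j\in\{1,\dots,d\}\big\}.$$ Let $\varphi$ be the translation invariant operator on $W=W_\nabla$ given by $$\varphi[f](x)=\sum_{y\in(\mathbb{Z}_\mu)^d}\langle K(x-y),f(y)\rangle,\qquad x\in(\mathbb{Z}_\mu)^d,$$ where $K\colon(\mathbb{Z}_\mu)^d\to\mathbb{C}^d$ satisfies $\sum_xK(x)=0$. Then the inequality $$\int_{\mathbb{T}}|\mathbb{I}_\alpha[F]|\,d\nu\leq C\Big(\sup_{n\ge0,\ \omega\in\mathcal{AF}_n}m^{(1-\alpha)n}\nu(\omega)\Big)\|F\|_{L_1}$$ holds with some constant $C$ for all simple martingales $F\in\mathbb{W}$ and all finite non-negative Borel measures $\nu$ on $\mathbb{T}$ with finite supremum if and only if $$\forall D\subset\{1,\dots,d\}\qquad \sum_{x\in(\mathbb{Z}_\mu)^d:\ \sum_{j\in D}x_j=0}\langle K(x),e_D\rangle=0,\qquad e_D=\sum_{j\in D}e_j.$$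
   Context: $(\mathbb{Z}_\mu)^d$ is the group of $d$-tuples of residues mod $\mu$; $e_1,\dots,e_d$ are its standard generators; the same symbols denote the standard basis vectors of $\mathbb{C}^d$ (as in $\langle K(x),e_D\rangle$). $\langle z,w\rangle=\sum_{j}z_jw_j$ on $\mathbb{C}^d$. The set $\{1,\dots,m\}$, $m=\mu^d$, which indexes the kids of an atom, is identified with $(\mathbb{Z}_\mu)^d$. $V$ is the space of real-valued functions on $(\mathbb{Z}_\mu)^d$ with zero sum; $V\otimes\mathbb{C}^d$ is the space of functions $g=(g_1,\dots,g_d)\colon(\mathbb{Z}_\mu)^d\to\mathbb{C}^d$ with zero sum. $\mathbb{T}$ is the space of sequences $\gamma=(\gamma(0),\gamma(1),\dots)$ with digits in $(\mathbb{Z}_\mu)^d$ (product topology). $\mathcal{AF}_n$ is the set of atoms of level $n$: the $m^n$ cylinder sets obtained by prescribing the first $n$ digits ($\mathcal{AF}_0=\{\mathbb{T}\}$). The $x$-th kid $\omega_x\in\mathcal{AF}_{n+1}$ of $\omega\in\mathcal{AF}_n$ is obtained by prescribing the next digit to be $x$. $\mathcal{F}_n$ is the finite algebra generated by $\mathcal{AF}_n$; $\mathbb{T}$ carries the probability measure giving mass $m^{-n}$ to each atom of level $n$. Martingales $F=\{F_n\}_{n\ge0}$ are $\mathbb{C}^d$-valued and adapted to $\{\mathcal F_n\}$; $dF_{n+1}=F_{n+1}-F_n$; $\|F\|_{L_1}=\sup_n\mathbb{E}|F_n|$; $F$ is simple if $F_n=F_N$ for all $n\ge N$, for some $N$. For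 $\omega\in\mathcal{AF}_n$, $dF_{n+1}[\omega]\in V\otimes\mathbb{C}^d$ is the function $x\mapsto dF_{n+1}|_{\omega_x}$. $\mathbb{W}$ is the set of such martingales with $\|F\|_{L_1}<\infty$ and $dF_{n+1}[\omega]\in W$ for all $n\ge0$, $\omega\in\mathcal{AF}_n$. Finally $$\mathbb{I}_\alpha[F]=\sum_{n\ge0}m^{-\alpha n}\sum_{\omega\in\mathcal{AF}_n}\ \sum_{x\in(\mathbb{Z}_\mu)^d}\varphi\big(dF_{n+1}[\omega]\big)(x)\,\chi_{\omega_x}.$$ *)

theory Defs
  imports "HOL-Probability.Probability" "Berlekamp_Zassenhaus.Finite_Field"
begin

text \<open>
  The \<open>m\<close>-ary tree. The digits (which index the kids of an atom) range over a finite
  type \<open>'x\<close>, so \<open>m = CARD('x)\<close>, and the space \<open>\<T>\<close> is the type \<open>nat \<Rightarrow> 'x\<close>.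
\<close>

definition atoms :: "nat \<Rightarrow> (nat \<Rightarrow> 'x) set set" where
  "atoms n = range (\<lambda>w. {\<gamma>. \<forall>i<n. \<gamma> i = w i})"

text \<open>For \<open>\<omega> \<in> atoms n\<close>; the level is an argument, it is not read off from \<open>\<omega>\<close>.\<close>

definition kid :: "nat \<Rightarrow> (nat \<Rightarrow> 'x) set \<Rightarrow> 'x \<Rightarrow> (nat \<Rightarrow> 'x) set" where
  "kid n \<omega> x = {\<gamma> \<in> \<omega>. \<gamma> n = x}"

definition tree_topology :: "(nat \<Rightarrow> 'x) topology" where
  "tree_topology = product_topology (\<lambda>_. discrete_topology UNIV) UNIV"

definition tree_borel :: "(nat \<Rightarrow> 'x) measure" where
  "tree_borel = sigma UNIV {U. openin tree_topology U}"

text \<open>The probability measure giving mass \<open>m\<^sup>-\<^sup>n\<close> to each atom of level \<open>n\<close>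
  (lemma \<open>emeasure_tree_prob_atom\<close> below).\<close>

definition tree_prob :: "(nat \<Rightarrow> 'x::finite) measure" where
  "tree_prob = (\<Pi>\<^sub>M i\<in>UNIV. uniform_count_measure UNIV)"

text \<open>The generated algebra is finite, hence it is the generated sigma-algebra.\<close>

definition tree_filtration :: "nat \<Rightarrow> (nat \<Rightarrow> 'x) measure" where
  "tree_filtration n = sigma UNIV (atoms n)"

text \<open>The last clause says \<open>E(F (n + 1) | \<F>\<^sub>n) = F n\<close>, with the conditional expectation
  of a vector-valued function spelled out.\<close>

definition tree_martingale :: "(nat \<Rightarrow> (nat \<Rightarrow> 'x::finite) \<Rightarrow> complex ^ 'd) \<Rightarrow> bool" where
  "tree_martingale F \<longleftrightarrow>
     (\<forall>n. F n \<in> borel_measurable (tree_filtration n)) \<and>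
     (\<forall>n. integrable tree_prob (F n)) \<and>
     (\<forall>n. \<forall>A \<in> sets (tree_filtration n).
        (LINT \<gamma>:A|tree_prob. F (Suc n) \<gamma>) = (LINT \<gamma>:A|tree_prob. F n \<gamma>))"

definition L1_norm :: "(nat \<Rightarrow> (nat \<Rightarrow> 'x::finite) \<Rightarrow> complex ^ 'd) \<Rightarrow> ennreal" where
  "L1_norm F = (SUP n. \<integral>\<^sup>+\<gamma>. ennreal (norm (F n \<gamma>)) \<partial>tree_prob)"

definition simple_martingale :: "(nat \<Rightarrow> (nat \<Rightarrow> 'x) \<Rightarrow> complex ^ 'd) \<Rightarrow> bool" where
  "simple_martingale F \<longleftrightarrow> (\<exists>N. \<forall>n\<ge>N. F n = F N)"

text \<open>The value of \<open>f\<close> on a set where \<open>f\<close> is constant.\<close>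

definition value_on :: "('a \<Rightarrow> 'b) \<Rightarrow> 'a set \<Rightarrow> 'b" where
  "value_on f A = (THE v. \<forall>a\<in>A. f a = v)"

text \<open>\<open>mart_diff F n \<omega>\<close> is \<open>dF\<^sub>n\<^sub>+\<^sub>1[\<omega>]\<close>.\<close>

definition mart_diff ::
  "(nat \<Rightarrow> (nat \<Rightarrow> 'x) \<Rightarrow> complex ^ 'd) \<Rightarrow> nat \<Rightarrow> (nat \<Rightarrow> 'x) set \<Rightarrow> 'x \<Rightarrow> complex ^ 'd" where
  "mart_diff F n \<omega> x = value_on (\<lambda>\<gamma>. F (Suc n) \<gamma> - F n \<gamma>) (kid n \<omega> x)"

definition mart_space ::
  "('x::finite \<Rightarrow> complex ^ 'd) set \<Rightarrow> (nat \<Rightarrow> (nat \<Rightarrow> 'x) \<Rightarrow> complex ^ 'd) set" where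
  "mart_space W = {F. tree_martingale F \<and> L1_norm F < \<infinity> \<and>
     (\<forall>n. \<forall>\<omega> \<in> atoms n. mart_diff F n \<omega> \<in> W)}"

definition frac_integral ::
  "real \<Rightarrow> (('x::finite \<Rightarrow> complex ^ 'd) \<Rightarrow> 'x \<Rightarrow> complex) \<Rightarrow>
   (nat \<Rightarrow> (nat \<Rightarrow> 'x) \<Rightarrow> complex ^ 'd) \<Rightarrow> (nat \<Rightarrow> 'x) \<Rightarrow> complex" where
  "frac_integral \<alpha> \<phi> F \<gamma> =
     (\<Sum>n. of_real (real CARD('x) powr (- \<alpha> * real n)) *
        (\<Sum>\<omega>\<in>atoms n. \<Sum>x\<in>UNIV. \<phi> (mart_diff F n \<omega>) x * indicator (kid n \<omega> x) \<gamma>))"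

definition growth_const :: "real \<Rightarrow> (nat \<Rightarrow> 'x::finite) measure \<Rightarrow> ennreal" where
  "growth_const \<alpha> \<nu> =
     (SUP n. SUP \<omega>\<in>atoms n.
        ennreal (real CARD('x) powr ((1 - \<alpha>) * real n)) * emeasure \<nu> \<omega>)"

text \<open>
  The group \<open>(\<int>\<^sub>\<mu>)\<^sup>d\<close> is the type \<open>'mu mod_ring ^ 'd\<close> with \<open>\<mu> = CARD('mu)\<close> and
  \<open>d = CARD('d)\<close>; the class \<open>nontriv\<close> means \<open>\<mu> \<ge> 2\<close>. Both the generators of this group and
  the standard basis vectors of \<open>\<complex>\<^sup>d\<close> are \<open>axis j 1\<close>.
\<close>

text \<open>Bilinear, without conjugation, unlike a complex inner product; the library's
  \<open>inner\<close> on this type is the real inner product.\<close>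

definition pairing :: "complex ^ 'd \<Rightarrow> complex ^ 'd \<Rightarrow> complex" where
  "pairing z w = (\<Sum>j\<in>UNIV. z $ j * w $ j)"

definition V_tensor :: "('x::finite \<Rightarrow> complex ^ 'd) set" where
  "V_tensor = {g. (\<Sum>x\<in>UNIV. g x) = 0}"

definition W_nabla :: "('mu::nontriv mod_ring ^ 'd \<Rightarrow> complex ^ 'd) set" where
  "W_nabla = {g \<in> V_tensor. \<exists>f :: 'mu mod_ring ^ 'd \<Rightarrow> complex.
     \<forall>x j. g x $ j = f (x + axis j 1) - f x}"

definition conv_op ::
  "('x::{finite, ab_group_add} \<Rightarrow> complex ^ 'd) \<Rightarrow> ('x \<Rightarrow> complex ^ 'd) \<Rightarrow> 'x \<Rightarrow> complex" where
  "conv_op K g x = (\<Sum>y\<in>UNIV. pairing (K (x - y)) (g y))"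

lemma card_mod_ring_vec: "CARD('mu::finite mod_ring ^ 'd) = CARD('mu) ^ CARD('d)"
  by simp

lemma atom_eq_prod_emb:
  "{\<gamma>. \<forall>i<n. \<gamma> i = w i} =
     prod_emb UNIV (\<lambda>_. uniform_count_measure (UNIV :: 'x::finite set)) {..<n} (\<Pi>\<^sub>E i\<in>{..<n}. {w i})"
  by (auto simp: prod_emb_def PiE_iff space_uniform_count_measure restrict_def extensional_def)

lemma emeasure_tree_prob_atom:
  assumes "\<omega> \<in> (atoms n :: (nat \<Rightarrow> 'x::finite) set set)"
  shows "emeasure tree_prob \<omega> = ennreal (1 / real CARD('x) ^ n)"
proof -
  interpret product_prob_space "\<lambda>_::nat. uniform_count_measure (UNIV :: 'x set)" UNIV
    by (intro product_prob_spaceI prob_space_uniform_count_measure) auto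
  obtain w where \<omega>: "\<omega> = {\<gamma>. \<forall>i<n. \<gamma> i = w i}"
    using assms by (auto simp: atoms_def)
  show ?thesis
    unfolding \<omega> tree_prob_def atom_eq_prod_emb
    by (subst emeasure_PiM_emb)
       (auto simp: sets_uniform_count_measure emeasure_uniform_count_measure
         prod_ennreal power_one_over ennreal_power)
qed

lemma sets_tree_prob: "sets (tree_prob :: (nat \<Rightarrow> 'x::finite) measure) = sets tree_borel"
proof -
  let ?M = "\<lambda>_::nat. uniform_count_measure (UNIV :: 'x set)"
  let ?T = "tree_topology :: (nat \<Rightarrow> 'x) topology"
  have space: "space (tree_prob :: (nat \<Rightarrow> 'x) measure) = UNIV"
    by (simp add: tree_prob_def space_PiM space_uniform_count_measure)
  have fin: "finite (atoms n :: (nat \<Rightarrow> 'x) set set)" for n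
  proof -
    have "atoms n \<subseteq> (\<lambda>w. {\<gamma>. \<forall>i<n. \<gamma> i = w i}) ` (PiE {..<n} (\<lambda>_. UNIV :: 'x set))"
    proof
      fix \<omega> :: "(nat \<Rightarrow> 'x) set" assume "\<omega> \<in> atoms n"
      then obtain w where "\<omega> = {\<gamma>. \<forall>i<n. \<gamma> i = w i}" by (auto simp: atoms_def)
      then have "\<omega> = {\<gamma>. \<forall>i<n. \<gamma> i = restrict w {..<n} i}" by auto
      then show "\<omega> \<in> (\<lambda>w. {\<gamma>. \<forall>i<n. \<gamma> i = w i}) ` (PiE {..<n} (\<lambda>_. UNIV :: 'x set))"
        by (intro image_eqI[of _ _ "restrict w {..<n}"]) auto
    qed
    then show ?thesis by (rule finite_subset) (intro finite_imageI finite_PiE; simp)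
  qed
  have atom: "\<omega> \<in> sets tree_prob" if \<omega>: "\<omega> \<in> atoms n" for n and \<omega> :: "(nat \<Rightarrow> 'x) set"
  proof -
    obtain w where "\<omega> = {\<gamma>. \<forall>i<n. \<gamma> i = w i}" using \<omega> by (auto simp: atoms_def)
    then show ?thesis
      unfolding tree_prob_def by (auto simp: atom_eq_prod_emb sets_uniform_count_measure
          intro!: sets_PiM_I)
  qed
  have "U \<in> sets tree_prob" if U: "openin ?T U" for U
  proof -
    have "U = \<Union> (\<Union>n. {\<omega> \<in> atoms n. \<omega> \<subseteq> U})"
    proof (intro equalityI subsetI)
      fix \<gamma> assume "\<gamma> \<in> U"
      then obtain X where X: "\<gamma> \<in> Pi\<^sub>E UNIV X" "finite {i. X i \<noteq> (UNIV :: 'x set)}"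
          "Pi\<^sub>E UNIV X \<subseteq> U"
        using product_topology_open_contains_basis[of "\<lambda>_. discrete_topology UNIV" UNIV U \<gamma>] U
        by (auto simp: tree_topology_def)
      obtain n where "\<And>i. X i \<noteq> UNIV \<Longrightarrow> i < n"
        using X(2) by (auto simp: finite_nat_set_iff_bounded)
      then have "{\<gamma>'. \<forall>i<n. \<gamma>' i = \<gamma> i} \<subseteq> Pi\<^sub>E UNIV X"
        using X(1) by (fastforce simp: PiE_iff)
      then have "{\<gamma>'. \<forall>i<n. \<gamma>' i = \<gamma> i} \<subseteq> U" using X(3) by blast
      then show "\<gamma> \<in> \<Union> (\<Union>n. {\<omega> \<in> atoms n. \<omega> \<subseteq> U})"
        by (auto simp: atoms_def)
    qed auto
    also have "\<dots> \<in> sets tree_prob"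
    proof (rule sets.countable_Union)
      have "finite {\<omega> \<in> atoms n. \<omega> \<subseteq> U}" for n
        using fin[of n] by simp
      then show "countable (\<Union>n. {\<omega> \<in> atoms n. \<omega> \<subseteq> U})"
        by (simp add: countable_finite)
    qed (auto intro: atom)
    finally show ?thesis .
  qed
  then have "Collect (openin ?T) \<subseteq> sets tree_prob" by blast
  from sets.sigma_sets_subset[OF this]
  have "sets tree_borel \<subseteq> sets (tree_prob :: (nat \<Rightarrow> 'x) measure)"
    by (simp add: tree_borel_def space)
  moreover have "sets (tree_prob :: (nat \<Rightarrow> 'x) measure) \<subseteq> sets tree_borel"
  proof -
    have "{f. f i \<in> A} \<in> sets tree_borel" for i and A :: "'x set"
    proof -
      have "openin ?T {f \<in> topspace ?T. f i \<in> A}"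
        unfolding tree_topology_def
        by (rule openin_continuous_map_preimage[OF continuous_map_product_projection]) auto
      then show ?thesis
        by (auto simp: tree_borel_def tree_topology_def)
    qed
    then have "{{f \<in> \<Pi>\<^sub>E i\<in>UNIV. space (?M i). f i \<in> A} |i A. i \<in> UNIV \<and> A \<in> sets (?M i)}
        \<subseteq> sets tree_borel"
      by (auto simp: space_uniform_count_measure)
    from sets.sigma_sets_subset[OF this] show ?thesis
      by (simp add: tree_prob_def sets_PiM_single space_uniform_count_measure tree_borel_def)
  qed
  ultimately show ?thesis by blast
qed

end

theory Submission
  imports Defs
begin

text \<open>
  Let \<open>\<mu> = CARD('mu)\<close> and \<open>m = \<mu>\<^sup>d\<close>, so that \<open>m\<^sup>1\<^sup>-\<^sup>1\<^sup>/\<^sup>d = m / \<mu>\<close>. For a set \<open>D\<close> of directions, the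
  level of \<open>x\<close> is \<open>\<Sum>\<^sub>j\<^sub>\<in>\<^sub>D x\<^sub>j\<close>, and \<open>c\<^sub>D\<close> denotes the sum in the cancellation condition.

  \<^bold>\<open>The critical configurations.\<close> On an atom where the martingale has the value \<open>a\<close>, its values on the
  kids are \<open>b x = a + g x\<close> with a gradient \<open>g\<close>. The growth of \<open>E |F\<^sub>n|\<close> pays for the increment \<open>g\<close>, unless
  \<open>b\<close> has no cancellation, that is \<open>b x = h x a\<close> with \<open>h \<ge> 0\<close>. Gradients of this form are rigid:
  if \<open>a \<noteq> 0\<close>, then \<open>h\<close> depends only on the level of \<open>x\<close> for some nonempty \<open>D\<close>
  (\<open>flat_gradient_structure\<close>); if \<open>h\<close> is not constant, then moreover \<open>a\<close> is a multiple of \<open>e\<^sub>D\<close>. The extreme case is that \<open>b\<close> is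
  concentrated on one level set, and that the measure \<open>\<nu>\<close> is uniform on the same level set: nothing is
  gained in such a step, and the operator contributes a multiple of \<open>c\<^sub>D\<close>.

  \<^bold>\<open>Necessity.\<close> Repeating the extreme step \<open>N\<close> times, with the level set of level \<open>0\<close>, gives a martingale
  of norm \<open>|e\<^sub>D|\<close> and a measure with growth constant at most \<open>1\<close>, while the integral on the left is
  \<open>N \<mu> |c\<^sub>D|\<close> (\<open>frac_integral_level_martingale\<close>). Hence \<open>c\<^sub>D = 0\<close>.

  \<^bold>\<open>Sufficiency.\<close> This is a Bellman function argument (\<open>telescoping_bound\<close>). Let \<open>G\<close> be the growth
  constant and let \<open>\<rho>(\<omega>) = (m / \<mu>)\<^sup>n \<nu>(\<omega>) / G\<close>, a number in \<open>[0, 1]\<close>, be the normalized density of \<open>\<nu>\<close>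
  on an atom of level \<open>n\<close>. The cost of step \<open>n\<close> is bounded by the decrease of \<open>E (|F\<^sub>n| \<surd>\<rho>)\<close> plus the
  growth of \<open>E |F\<^sub>n|\<close>, up to constants, and both telescope. The concavity of the square root
  matters. The weight \<open>\<rho>\<close> itself handles exactly flat \<open>b\<close>, but not its perturbations: mass of \<open>b\<close> may
  leave the level set at a point where \<open>\<nu>\<close> has a hole, which costs a first-order amount and
  changes \<open>E (|F\<^sub>n| \<rho>)\<close> and \<open>E |F\<^sub>n|\<close> by second-order amounts only. With a strictly concave weight, a density that
  is not uniform on the level set already pays a fixed amount. It is \<open>\<surd>\<rho>\<close> rather than, say,
  \<open>\<rho> (2 - \<rho>)\<close> because that amount must not be small compared with \<open>\<rho>\<close> when \<open>\<rho>\<close> is small.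

  The bound for a single step (\<open>local_inequality\<close>) is a statement about finitely many variables, \<open>b\<close> and
  the densities \<open>r\<close> on the kids. It follows by compactness, except near its zero set. There
  \<open>b = c e\<^sub>D\<close> and \<open>r = 1\<close> on a level set (\<open>degenerate_structure\<close>), and a direct estimate, in
  which the cancellation condition enters, is available (\<open>local_bound_near_level_set\<close>).
\<close>

section \<open>Level sets in the group\<close>

definition level :: "'d set \<Rightarrow> 'a::comm_monoid_add ^ 'd \<Rightarrow> 'a" where
  "level D x = (\<Sum>j\<in>D. x $ j)"

lemma level_add: "level D (x + y) = level D x + level D y"
  by (simp add: level_def sum.distrib)

lemma level_diff: "level D (x - y) = level D x - level D y"
  for x y :: "'a::ab_group_add ^ 'd"
  by (simp add: level_def sum_subtractf)

lemma level_axis: "level D (axis j k :: 'a::comm_monoid_add ^ 'd::finite) = (if j \<in> D then k else 0)"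
  by (simp add: level_def axis_def)

lemma card_level:
  fixes D :: "'d::finite set" and t :: "'a::{finite, ab_group_add}"
  assumes "D \<noteq> {}"
  shows "CARD('a) * card {x :: 'a ^ 'd. level D x = t} = CARD('a ^ 'd)"
proof -
  obtain j where j: "j \<in> D" using assms by blast
  have eq: "card {x :: 'a ^ 'd. level D x = s} = card {x :: 'a ^ 'd. level D x = t}" for s
    by (rule bij_betw_same_card[of "\<lambda>x. x + axis j (t - s)"],
        rule bij_betwI[where g = "\<lambda>x. x - axis j (t - s)"])
       (use j in \<open>auto simp: level_add level_diff level_axis\<close>)
  have "CARD('a ^ 'd) = (\<Sum>x\<in>(UNIV :: ('a ^ 'd) set). 1)" by simp
  also have "\<dots> = (\<Sum>s\<in>(UNIV :: 'a set). \<Sum>x\<in>{x :: 'a ^ 'd. x \<in> UNIV \<and> level D x = s}. 1)"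
    by (rule sum.group[symmetric]) auto
  also have "\<dots> = (\<Sum>s\<in>(UNIV :: 'a set). card {x :: 'a ^ 'd. level D x = s})" by simp
  also have "\<dots> = (\<Sum>s\<in>(UNIV :: 'a set). card {x :: 'a ^ 'd. level D x = t})"
    by (rule sum.cong[OF refl eq])
  also have "\<dots> = CARD('a) * card {x :: 'a ^ 'd. level D x = t}" by simp
  finally show ?thesis by simp
qed

lemma card_level_real:
  fixes D :: "'d::finite set" and t :: "'a::{finite, ab_group_add}"
  assumes "D \<noteq> {}"
  shows "real (card {x :: 'a ^ 'd. level D x = t}) = real CARD('a ^ 'd) / real CARD('a)"
  unfolding card_level[OF assms, of t, symmetric] by simp

lemma mod_ring_of_nat_surj:
  fixes k :: "'mu::nontriv mod_ring"
  obtains n where "k = of_nat n"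
proof
  have "0 \<le> to_int_mod_ring k"
    using range_to_int_mod_ring[where 'a = 'mu] by (metis atLeastLessThan_iff rangeI)
  then show "k = of_nat (nat (to_int_mod_ring k))"
    by (simp add: of_nat_of_int_mod_ring)
qed

lemma axis_add: "axis j (a + b) = (axis j a + axis j b :: 'a::monoid_add ^ 'd::finite)"
  by (vector axis_def)

text \<open>The elements of level \<open>0\<close> are generated by \<open>e\<^sub>j\<close> for \<open>j \<notin> D\<close> and \<open>e\<^sub>j - e\<^sub>i\<close> for \<open>j \<in> D\<close>, so
  invariance under these translations is invariance along the level sets.\<close>

lemma function_of_level:
  fixes h :: "'mu::nontriv mod_ring ^ 'd::finite \<Rightarrow> 'b"
  assumes i: "i \<in> D"
    and out: "\<And>x j. j \<notin> D \<Longrightarrow> h (x + axis j 1) = h x"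
    and ins: "\<And>x j. j \<in> D \<Longrightarrow> h (x + axis j 1) = h (x + axis i 1)"
    and lev: "level D x = level D y"
  shows "h x = h y"
proof -
  define G where "G = {v. \<forall>x. h (x + v) = h x}"
  have G0: "0 \<in> G" by (simp add: G_def)
  have Gadd: "v + w \<in> G" if "v \<in> G" "w \<in> G" for v w
    using that by (simp add: G_def add.assoc[symmetric])
  have Gmult: "of_nat n *s v \<in> G" if "v \<in> G" for n and v :: "'mu mod_ring ^ 'd"
  proof (induction n)
    case (Suc n)
    have "of_nat (Suc n) *s v = v + of_nat n *s v"
      by (simp add: vec_eq_iff distrib_right)
    with Suc Gadd[OF that] show ?case by simp
  qed (simp add: G0)
  have Gsum: "(\<Sum>j\<in>A. w j) \<in> G" if "\<And>j. w j \<in> G" for w and A :: "'d set"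
    by (induction A rule: infinite_finite_induct) (auto intro: G0 Gadd that)
  \<comment> \<open>Replacing \<open>e\<^sub>j\<close> by \<open>w j\<close> in \<open>y - x = \<Sum>\<^sub>j (y - x)\<^sub>j e\<^sub>j\<close> changes the sum by a multiple of \<open>level D (y - x) = 0\<close>.\<close>
  define w where "w j = (axis j 1 - (if j \<in> D then axis i 1 else 0) :: 'mu mod_ring ^ 'd)" for j
  have "w j \<in> G" for j
  proof (cases "j \<in> D")
    case True
    have "h (x + w j) = h x" for x
      using ins[OF True, of "x - axis i 1"] True by (simp add: w_def algebra_simps)
    then show ?thesis by (simp add: G_def)
  next
    case False
    then show ?thesis by (simp add: G_def w_def out)
  qed
  then have wG: "(y - x) $ j *s w j \<in> G" for j
    by (rule_tac k = "(y - x) $ j" in mod_ring_of_nat_surj) (simp add: Gmult del: vector_minus_component)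
  have "y - x = (\<Sum>j\<in>UNIV. (y - x) $ j *s w j)"
  proof (subst vec_eq_iff, rule allI)
    fix k
    have L: "(\<Sum>j\<in>D. (y - x) $ j) = 0"
      using lev unfolding level_def by (simp add: sum_subtractf)
    have "(\<Sum>j\<in>UNIV. (y - x) $ j *s w j) $ k
      = (\<Sum>j\<in>UNIV. (y - x) $ j * axis j 1 $ k) - (\<Sum>j\<in>UNIV. if j \<in> D then (y - x) $ j * axis i 1 $ k else 0)"
      unfolding sum_component sum_subtractf[symmetric]
      by (rule sum.cong) (auto simp: w_def algebra_simps)
    also have "(\<Sum>j\<in>UNIV. if j \<in> D then (y - x) $ j * axis i 1 $ k else 0) = (\<Sum>j\<in>D. (y - x) $ j) * axis i 1 $ k"
      by (simp add: sum.If_cases sum_distrib_right)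
    also have "\<dots> = 0" unfolding L by simp
    also have "(\<Sum>j\<in>UNIV. (y - x) $ j * axis j 1 $ k) = (\<Sum>j\<in>UNIV. if k = j then (y - x) $ j else 0)"
      by (rule sum.cong) (auto simp: axis_def)
    also have "\<dots> = (y - x) $ k" by simp
    finally show "(y - x) $ k = (\<Sum>j\<in>UNIV. (y - x) $ j *s w j) $ k" by simp
  qed
  also have "\<dots> \<in> G" by (intro Gsum wG)
  finally have "h (x + (y - x)) = h x" unfolding G_def by blast
  then show ?thesis by simp
qed

lemma sum_shift: "(\<Sum>x\<in>UNIV. f (x + v)) = (\<Sum>x\<in>UNIV. f x)"
  for f :: "'a::{finite, ab_group_add} \<Rightarrow> 'b::comm_monoid_add"
  by (rule sum.reindex_bij_betw, rule bij_betwI[where g = "\<lambda>x. x - v"]) auto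

text \<open>Rigidity of the curl-free fields \<open>h s\<close> with a fixed vector \<open>s\<close> and a real function \<open>h\<close>. Let \<open>E\<^sub>j\<close> be the
  energy \<open>\<Sum>\<^sub>x (h (x + e\<^sub>j) - h x)\<^sup>2\<close>. Multiplying the curl identity by \<open>h x\<close> and summing gives
  \<open>E\<^sub>k s\<^sub>j = E\<^sub>j s\<^sub>k\<close>, because \<open>\<Sum>\<^sub>x h x (h (x + e\<^sub>j) - h x) = - E\<^sub>j / 2\<close>; squaring it and summing gives
  \<open>E\<^sub>k |s\<^sub>j|\<^sup>2 = E\<^sub>j |s\<^sub>k|\<^sup>2\<close>. Together they force \<open>s\<^sub>j = s\<^sub>k\<close> whenever both are nonzero and
  \<open>h\<close> is not constant, and then the curl identity says that all steps \<open>e\<^sub>j\<close> with \<open>s\<^sub>j \<noteq> 0\<close> change \<open>h\<close>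
  in the same way, while the other steps leave it unchanged.\<close>

lemma flat_gradient_structure:
  fixes h :: "'mu::nontriv mod_ring ^ 'd::finite \<Rightarrow> real" and s :: "complex ^ 'd"
  assumes curl: "\<And>x i j. of_real (h (x + axis j 1) - h x) * s $ i = of_real (h (x + axis i 1) - h x) * s $ j"
    and "s \<noteq> 0"
  shows "\<exists>D. D \<noteq> {} \<and> (\<forall>x y. level D x = level D y \<longrightarrow> h x = h y)"
proof -
  define D where "D = {j. s $ j \<noteq> 0}"
  obtain i where i: "i \<in> D" using \<open>s \<noteq> 0\<close> by (auto simp: D_def vec_eq_iff)
  define E where "E j = (\<Sum>x\<in>UNIV. (h (x + axis j 1) - h x)\<^sup>2)" for j
  have E0: "E j = 0 \<longleftrightarrow> (\<forall>x. h (x + axis j 1) = h x)" for j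
    unfolding E_def by (subst sum_nonneg_eq_0_iff) auto
  have half: "(\<Sum>x\<in>UNIV. h x * (h (x + axis j 1) - h x)) = - E j / 2" for j
  proof -
    have "E j = (\<Sum>x\<in>UNIV. (h (x + axis j 1))\<^sup>2 - (h x)\<^sup>2 - 2 * (h x * (h (x + axis j 1) - h x)))"
      unfolding E_def by (rule sum.cong) (auto simp: power2_eq_square algebra_simps)
    also have "\<dots> = (\<Sum>x\<in>UNIV. (h (x + axis j 1))\<^sup>2) - (\<Sum>x\<in>UNIV. (h x)\<^sup>2)
        - 2 * (\<Sum>x\<in>UNIV. h x * (h (x + axis j 1) - h x))"
      by (simp add: sum_subtractf sum_distrib_left)
    also have "(\<Sum>x\<in>UNIV. (h (x + axis j 1))\<^sup>2) = (\<Sum>x\<in>UNIV. (h x)\<^sup>2)"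
      by (rule sum_shift)
    finally show ?thesis by simp
  qed
  have lin: "of_real (E k) * s $ j = of_real (E j) * s $ k" for j k
  proof -
    have "(\<Sum>x\<in>UNIV. of_real (h x) * (of_real (h (x + axis k 1) - h x) * s $ j))
        = (\<Sum>x\<in>UNIV. of_real (h x) * (of_real (h (x + axis j 1) - h x) * s $ k))"
      by (rule sum.cong) (auto simp only: curl[of _ k j])
    then have "of_real (\<Sum>x\<in>UNIV. h x * (h (x + axis k 1) - h x)) * s $ j
       = of_real (\<Sum>x\<in>UNIV. h x * (h (x + axis j 1) - h x)) * s $ k"
      by (simp add: sum_distrib_right mult.assoc)
    then show ?thesis unfolding half by simp
  qed
  have quad: "E k * (norm (s $ j))\<^sup>2 = E j * (norm (s $ k))\<^sup>2" for j k
  proof -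
    have "((h (x + axis k 1) - h x) * norm (s $ j))\<^sup>2 = ((h (x + axis j 1) - h x) * norm (s $ k))\<^sup>2" for x
      using arg_cong[OF curl[of x k j], of "\<lambda>z. (norm z)\<^sup>2"]
      by (simp add: norm_mult power_mult_distrib del: of_real_diff)
    then show ?thesis
      unfolding E_def by (simp add: sum_distrib_right power_mult_distrib)
  qed
  have out: "h (x + axis j 1) = h x" if "j \<notin> D" for x j
    using curl[of x j i] that i by (auto simp: D_def)
  have ins: "h (x + axis j 1) = h (x + axis i 1)" if j: "j \<in> D" for x j
  proof (cases "E i = 0")
    case True
    then have "E j = 0" using lin[of j i] i by (simp add: D_def)
    with True show ?thesis by (simp add: E0)
  next
    case False
    have Ei: "E i > 0" using False by (simp add: E_def less_le sum_nonneg)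
    have n: "norm (s $ i) > 0" "norm (s $ j) > 0" using i j by (auto simp: D_def)
    have Ej: "E j \<ge> 0" by (simp add: E_def sum_nonneg)
    have "E j * norm (s $ i) = E i * norm (s $ j)"
      using arg_cong[OF lin[of j i], of norm] Ei Ej by (simp add: norm_mult)
    then have "E i * norm (s $ j) * norm (s $ i) = E i * norm (s $ j) * norm (s $ j)"
      using quad[of j i] by (metis power2_eq_square mult.assoc)
    then have ns: "norm (s $ i) = norm (s $ j)" using Ei n by simp
    with \<open>E j * norm (s $ i) = E i * norm (s $ j)\<close> n have "E j = E i" by simp
    with lin[of j i] Ei have "s $ i = s $ j" by simp
    with curl[of x j i] i show ?thesis by (simp add: D_def)
  qed
  show ?thesis
    using i function_of_level[of i D h, OF i out ins] by blast
qed

section \<open>Constants plus gradients, and the convolution operator\<close>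

text \<open>The functions \<open>a + \<nabla>f\<close>, described without \<open>a\<close> and \<open>f\<close>: the mixed differences agree, and the sum
  of the component \<open>j\<close> over a closed line in direction \<open>e\<^sub>j\<close> does not depend on the line. Being linear equations, these
  conditions define a closed set.\<close>

definition affine_gradient :: "('mu::nontriv mod_ring ^ 'd \<Rightarrow> complex ^ 'd) \<Rightarrow> bool" where
  "affine_gradient b \<longleftrightarrow>
     (\<forall>x i j. b (x + axis j 1) $ i - b x $ i = b (x + axis i 1) $ j - b x $ j) \<and>
     (\<forall>x y j. (\<Sum>k\<in>UNIV. b (x + axis j k) $ j) = (\<Sum>k\<in>UNIV. b (y + axis j k) $ j))"

lemma affine_gradient_W_nabla:
  fixes g :: "'mu::nontriv mod_ring ^ 'd::finite \<Rightarrow> complex ^ 'd"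
  assumes "g \<in> W_nabla"
  shows "affine_gradient (\<lambda>x. a + g x)"
proof -
  obtain f where f: "\<And>x j. g x $ j = f (x + axis j 1) - f x"
    using assms by (auto simp: W_nabla_def)
  have "(\<Sum>k\<in>UNIV. g (x + axis j k) $ j) = 0" for x j
  proof -
    have "(\<Sum>k\<in>UNIV. g (x + axis j k) $ j)
        = (\<Sum>k\<in>UNIV. f (x + axis j (k + 1))) - (\<Sum>k\<in>UNIV. f (x + axis j k))"
      by (simp add: f axis_add sum_subtractf add.assoc)
    also have "(\<Sum>k\<in>UNIV. f (x + axis j (k + 1))) = (\<Sum>k\<in>UNIV. f (x + axis j k))"
      by (rule sum_shift[of "\<lambda>k. f (x + axis j k)"])
    finally show ?thesis by simp
  qed
  then show ?thesis
    unfolding affine_gradient_def by (simp add: sum.distrib f add_ac)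
qed

lemma norm_vec_le_sum: "norm (z :: complex ^ 'd::finite) \<le> (\<Sum>j\<in>UNIV. norm (z $ j))"
  unfolding norm_vec_def by (rule L2_set_le_sum) simp

text \<open>A field of this kind that is small off a level set is almost \<open>c e\<^sub>D\<close> on it, with an error linear
  in \<open>\<epsilon>\<close>. A line in direction \<open>j \<in> D\<close> meets the level set once, so the component \<open>j\<close> there is the
  common line sum \<open>P\<^sub>j\<close> up to \<open>O(\<epsilon>)\<close>. The curl identities along the sides \<open>e\<^sub>i\<close> (\<open>i \<in> D\<close>) and \<open>e\<^sub>j\<close>
  involve points off the level set only, except for one or two corners; they make the components
  \<open>j \<notin> D\<close> small and the numbers \<open>P\<^sub>j\<close>, \<open>j \<in> D\<close>, almost equal.\<close>

lemma affine_gradient_near_level_set: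
  fixes b :: "'mu::nontriv mod_ring ^ 'd::finite \<Rightarrow> complex ^ 'd" and t :: "'mu mod_ring"
  assumes b: "affine_gradient b" and D: "D \<noteq> {}"
  defines "\<epsilon> \<equiv> (\<Sum>y | level D y \<noteq> t. norm (b y))"
  shows "\<exists>c. \<forall>y. norm (b y - (if level D y = t then c *s (\<Sum>j\<in>D. axis j 1) else 0))
           \<le> real CARD('d) * (5 * real CARD('mu)) * \<epsilon>"
proof -
  let ?\<mu> = "real CARD('mu)"
  have mu: "?\<mu> \<ge> 2" using nontriv[where 'a = 'mu] by simp
  have curl: "b (x + axis j 1) $ i - b x $ i = b (x + axis i 1) $ j - b x $ j" for x i j
    using b by (simp add: affine_gradient_def)
  have \<epsilon>0: "\<epsilon> \<ge> 0" by (simp add: \<epsilon>_def sum_nonneg)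
  have offn: "norm (b y) \<le> \<epsilon>" if "level D y \<noteq> t" for y
    unfolding \<epsilon>_def by (rule member_le_sum) (use that in auto)
  have off: "norm (b y $ j) \<le> \<epsilon>" if "level D y \<noteq> t" for y j
    using offn[OF that] order_trans[OF Finite_Cartesian_Product.norm_nth_le] by blast
  define P where "P j = (\<Sum>k\<in>UNIV. b (0 + axis j k) $ j)" for j
  have P: "P j = (\<Sum>k\<in>UNIV. b (y + axis j k) $ j)" for y j
    using b unfolding P_def affine_gradient_def by blast
  have onD: "norm (b y $ j - P j) \<le> ?\<mu> * \<epsilon>" if y: "level D y = t" and j: "j \<in> D" for y j
  proof -
    have z: "axis j 0 = (0 :: 'mu mod_ring ^ 'd)" by (simp add: vec_eq_iff axis_def)
    have "P j = b y $ j + (\<Sum>k\<in>UNIV - {0}. b (y + axis j k) $ j)"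
      unfolding P[of j y] by (subst sum.remove[of _ 0]) (auto simp: z)
    then have "norm (b y $ j - P j) = norm (\<Sum>k\<in>UNIV - {0}. b (y + axis j k) $ j)"
      by (simp add: norm_minus_commute)
    also have "\<dots> \<le> (\<Sum>k\<in>UNIV - {0 :: 'mu mod_ring}. \<epsilon>)"
      by (rule sum_norm_le, rule off) (use y j in \<open>auto simp: level_add level_axis\<close>)
    also have "\<dots> \<le> ?\<mu> * \<epsilon>"
      using \<epsilon>0 by (simp add: card_Diff_singleton mult_right_mono)
    finally show ?thesis .
  qed
  obtain i where i: "i \<in> D" using D by blast
  have offD: "norm (b y $ j) \<le> 3 * \<epsilon>" if y: "level D y = t" and j: "j \<notin> D" for y j
  proof -
    let ?x = "y - axis i 1"
    have "b y $ j = b ?x $ j + (b (?x + axis j 1) $ i - b ?x $ i)"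
      using curl[of ?x j i] by simp
    also have "norm \<dots> \<le> norm (b ?x $ j) + (norm (b (?x + axis j 1) $ i) + norm (b ?x $ i))"
      by (intro norm_triangle_le norm_triangle_ineq4 add_left_mono)
    also have "\<dots> \<le> \<epsilon> + (\<epsilon> + \<epsilon>)"
      by (intro add_mono off) (use y i j in \<open>auto simp: level_add level_diff level_axis\<close>)
    finally show ?thesis by simp
  qed
  have PP: "norm (P j - P i) \<le> 2 * \<epsilon> + 2 * ?\<mu> * \<epsilon>" if j: "j \<in> D" for j
  proof -
    define y :: "'mu mod_ring ^ 'd" where "y = axis i t"
    let ?x = "y - axis i 1"
    have y: "level D y = t" using i by (simp add: y_def level_axis)
    have y': "level D (?x + axis j 1) = t" using i j y by (simp add: level_add level_diff level_axis)
    have x: "level D ?x \<noteq> t" using y i by (simp add: level_add level_diff level_axis)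
    have "P j - P i = (b ?x $ j - b ?x $ i) - (b y $ j - P j) + (b (?x + axis j 1) $ i - P i)"
      using curl[of ?x j i] by (simp add: algebra_simps)
    also have "norm \<dots> \<le> ((norm (b ?x $ j) + norm (b ?x $ i)) + norm (b y $ j - P j)) + norm (b (?x + axis j 1) $ i - P i)"
      by (intro order_trans[OF norm_triangle_ineq] order_trans[OF norm_triangle_ineq4] add_right_mono) simp
    also have "\<dots> \<le> ((\<epsilon> + \<epsilon>) + ?\<mu> * \<epsilon>) + ?\<mu> * \<epsilon>"
      by (intro add_mono off onD x y y' i j)
    finally show ?thesis by (simp add: algebra_simps)
  qed
  define e where "e = (\<Sum>j\<in>D. axis j 1 :: complex ^ 'd)"
  have e: "e $ j = (if j \<in> D then 1 else 0)" for j
    unfolding e_def by (simp add: axis_def)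
  have \<mu>\<epsilon>: "2 * \<epsilon> \<le> ?\<mu> * \<epsilon>" using mu \<epsilon>0 by (rule mult_right_mono)
  have "norm (b y - (if level D y = t then P i *s e else 0)) \<le> real CARD('d) * (5 * ?\<mu>) * \<epsilon>" for y
  proof (cases "level D y = t")
    case True
    have "norm ((b y - P i *s e) $ j) \<le> 5 * ?\<mu> * \<epsilon>" for j
    proof (cases "j \<in> D")
      case j: True
      have "norm ((b y - P i *s e) $ j) = norm ((b y $ j - P j) + (P j - P i))"
        using j by (simp add: e)
      also have "\<dots> \<le> ?\<mu> * \<epsilon> + (2 * \<epsilon> + 2 * ?\<mu> * \<epsilon>)"
        by (intro order_trans[OF norm_triangle_ineq] add_mono onD PP True j)
      also have "\<dots> \<le> 5 * ?\<mu> * \<epsilon>" using \<mu>\<epsilon> \<epsilon>0 mu by linarith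
      finally show ?thesis .
    next
      case False
      then show ?thesis using offD[OF True False] \<mu>\<epsilon> \<epsilon>0 by (simp add: e)
    qed
    then have "(\<Sum>j\<in>UNIV. norm ((b y - P i *s e) $ j)) \<le> (\<Sum>j\<in>(UNIV :: 'd set). 5 * ?\<mu> * \<epsilon>)"
      by (intro sum_mono)
    from order_trans[OF norm_vec_le_sum this] True show ?thesis by (simp add: mult.assoc)
  next
    case False
    have "1 * \<epsilon> \<le> real CARD('d) * (5 * ?\<mu>) * \<epsilon>"
    proof (rule mult_right_mono[OF _ \<epsilon>0])
      have "1 \<le> real CARD('d)" by (simp add: Suc_le_eq)
      with mu show "1 \<le> real CARD('d) * (5 * ?\<mu>)" using mult_mono[of 1 "real CARD('d)" 1 "5 * ?\<mu>"] by simp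
    qed
    with offn[OF False] False show ?thesis by simp
  qed
  then show ?thesis unfolding e_def by blast
qed

lemma norm_pairing_le: "norm (pairing z w) \<le> (\<Sum>j\<in>UNIV. norm (z $ j)) * norm w"
  unfolding pairing_def sum_distrib_right
  by (intro sum_norm_le) (auto simp: norm_mult Finite_Cartesian_Product.norm_nth_le intro: mult_left_mono)

lemma conv_op_bounded:
  fixes K :: "'x::{finite, ab_group_add} \<Rightarrow> complex ^ 'd::finite"
  shows "\<exists>M>0. \<forall>g x. norm (conv_op K g x) \<le> M * (\<Sum>y\<in>UNIV. norm (g y))"
proof -
  define k where "k x = (\<Sum>j\<in>UNIV. norm (K x $ j))" for x
  have k0: "k x \<ge> 0" for x by (simp add: k_def sum_nonneg)
  have kle: "k x \<le> 1 + (\<Sum>x\<in>UNIV. k x)" for x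
    using member_le_sum[of x UNIV k] k0 by simp
  have "norm (conv_op K g x) \<le> (1 + (\<Sum>x\<in>UNIV. k x)) * (\<Sum>y\<in>UNIV. norm (g y))" for g x
    unfolding conv_op_def sum_distrib_left
    by (rule sum_norm_le, rule order_trans[OF norm_pairing_le], rule mult_right_mono)
       (use kle in \<open>auto simp: k_def\<close>)
  moreover have "1 + (\<Sum>x\<in>UNIV. k x) > 0" by (simp add: add_pos_nonneg k0 sum_nonneg)
  ultimately show ?thesis by blast
qed

lemma pairing_diff_right: "pairing z (v - w) = pairing z v - pairing z w"
  by (simp add: pairing_def right_diff_distrib sum_subtractf)

lemma pairing_scale_right: "pairing z (c *s v) = c * pairing z v"
  by (simp add: pairing_def sum_distrib_left mult_ac)

lemma pairing_zero_right [simp]: "pairing z 0 = 0"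
  by (simp add: pairing_def)

lemma conv_op_diff: "conv_op K (\<lambda>x. g x - g' x) x = conv_op K g x - conv_op K g' x"
  by (simp add: conv_op_def pairing_diff_right sum_subtractf)

lemma conv_op_zero [simp]: "conv_op K (\<lambda>x. 0) x = 0"
  by (simp add: conv_op_def)

lemma conv_op_add_const:
  fixes K :: "'x::{finite, ab_group_add} \<Rightarrow> complex ^ 'd::finite"
  assumes "(\<Sum>x\<in>UNIV. K x) = 0"
  shows "conv_op K (\<lambda>x. a + g x) x = conv_op K g x"
proof -
  have "(\<Sum>y\<in>UNIV. pairing (K (x - y)) a) = (\<Sum>y\<in>UNIV. pairing (K y) a)"
    by (rule sum.reindex_bij_betw, rule bij_betwI[where g = "\<lambda>y. x - y"]) auto
  also have "\<dots> = pairing (\<Sum>y\<in>UNIV. K y) a"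
    unfolding pairing_def by (subst sum.swap) (simp add: sum_distrib_right)
  also have "\<dots> = 0" using assms by (simp add: pairing_def)
  finally show ?thesis
    by (simp add: conv_op_def pairing_def distrib_left sum.distrib)
qed

text \<open>On a level set, the operator turns the concentrated field \<open>c v\<close> into a multiple of the sum that
  appears in the cancellation condition (for \<open>v = e\<^sub>D\<close>).\<close>

lemma conv_op_level_set:
  fixes K :: "'mu::nontriv mod_ring ^ 'd::finite \<Rightarrow> complex ^ 'd"
  assumes x: "level D x = t"
  shows "conv_op K (\<lambda>y. if level D y = t then c *s v else 0) x
      = c * (\<Sum>z | level D z = 0. pairing (K z) v)"
proof -
  have "conv_op K (\<lambda>y. if level D y = t then c *s v else 0) x
      = (\<Sum>y\<in>UNIV. if level D y = t then pairing (K (x - y)) (c *s v) else 0)"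
    unfolding conv_op_def by (rule sum.cong) auto
  also have "\<dots> = (\<Sum>y | level D y = t. pairing (K (x - y)) (c *s v))"
    by (simp add: sum.If_cases)
  also have "\<dots> = (\<Sum>z | level D z = 0. pairing (K z) (c *s v))"
    by (rule sum.reindex_bij_betw, rule bij_betwI[where g = "\<lambda>y. x - y"])
       (use x in \<open>auto simp: level_diff\<close>)
  finally show ?thesis by (simp add: pairing_scale_right sum_distrib_left)
qed

section \<open>The local inequality\<close>

lemma one_minus_sqrt_ge: "0 \<le> r \<Longrightarrow> 2 * (1 - sqrt r) \<ge> 1 - r"
  using sum_squares_bound[of 1 "sqrt r"] by (simp add: power2_eq_square)

text \<open>The only delicate configurations: \<open>b\<close> is concentrated near a level set \<open>S\<close> and \<open>r\<close> is close to \<open>1\<close>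
  there. Let \<open>\<epsilon>\<close> and \<open>\<sigma>\<close> be the masses of \<open>b\<close> and \<open>r\<close> off \<open>S\<close>. By the cancellation condition the
  operator kills \<open>c e\<^sub>D\<close> on \<open>S\<close>, so the left-hand side is \<open>O(\<epsilon> + \<sigma>)\<close>. On the right,
  \<open>2 (1 - \<surd>r) \<ge> 1 - r\<close>. Off \<open>S\<close>, the sum of \<open>|b| (1 - r)\<close> is \<open>\<epsilon>\<close> up to a small multiple of \<open>\<sigma>\<close>. On \<open>S\<close>,
  \<open>|b|\<close> is constant up to \<open>O(\<epsilon>)\<close> and bounded below, and the normalization of \<open>r\<close> makes the sum of
  \<open>1 - r\<close> equal to \<open>\<sigma>\<close>. So the right-hand side is at least a multiple of \<open>\<epsilon> + \<sigma>\<close>.\<close>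

lemma local_bound_near_level_set:
  fixes K :: "'mu::nontriv mod_ring ^ 'd::finite \<Rightarrow> complex ^ 'd" and t :: "'mu mod_ring"
  assumes D: "D \<noteq> {}" and \<beta>: "\<beta> > 0"
    and K: "(\<Sum>z | level D z = 0. pairing (K z) (\<Sum>j\<in>D. axis j 1)) = 0"
  shows "\<exists>\<tau>>0. \<exists>s>0. \<forall>b r. affine_gradient b \<longrightarrow> (\<Sum>x\<in>UNIV. norm (b x)) = 1 \<longrightarrow>
     (\<forall>x. 0 \<le> r x) \<longrightarrow> (\<Sum>x\<in>UNIV. r x) = real CARD('mu mod_ring ^ 'd) / real CARD('mu) \<longrightarrow>
     (\<forall>y. level D y \<noteq> t \<longrightarrow> norm (b y) \<le> \<tau>) \<longrightarrow>
     (\<forall>y. level D y = t \<longrightarrow> \<bar>r y - 1\<bar> \<le> \<tau> \<and> \<beta> \<le> norm (b y)) \<longrightarrow>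
     (\<Sum>x\<in>UNIV. r x * norm (conv_op K b x)) \<le> s * (\<Sum>x\<in>UNIV. norm (b x) * (1 - sqrt (r x)))"
proof -
  obtain M where M: "M > 0" "\<And>g x. norm (conv_op K g x) \<le> M * (\<Sum>y\<in>UNIV. norm (g y))"
    using conv_op_bounded[of K] by blast
  define m where "m = real CARD('mu mod_ring ^ 'd)"
  have m: "m \<ge> 1" by (simp add: m_def Suc_le_eq)
  define \<Lambda> where "\<Lambda> = real CARD('d) * (5 * real CARD('mu))"
  have \<Lambda>: "\<Lambda> > 0" by (simp add: \<Lambda>_def)
  define S where "S = {x :: 'mu mod_ring ^ 'd. level D x = t}"
  define q where "q = m / real CARD('mu)"
  have q: "real (card S) = q"
    using card_level_real[OF D, of t] unfolding S_def q_def m_def by (simp only: CARD_mod_ring)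
  have qm: "q \<le> m"
    unfolding q[symmetric] m_def S_def by (simp add: card_mono del: card_mod_ring_vec CARD_vec)
  \<comment> \<open>Small enough to absorb the errors: \<open>\<Lambda> m \<tau>\<close> bounds \<open>\<Lambda> \<epsilon>\<close>, and \<open>\<tau>\<close> bounds \<open>b\<close> off \<open>S\<close> and \<open>r - 1\<close> on \<open>S\<close>.\<close>
  define \<tau> where "\<tau> = min (min (\<beta> / 2) (1 / 2) / (\<Lambda> * m)) (\<beta> / 4)"
  have \<tau>0: "\<tau> > 0" using \<beta> \<Lambda> m by (simp add: \<tau>_def)
  have "\<tau> \<le> min (\<beta> / 2) (1 / 2) / (\<Lambda> * m)" by (simp add: \<tau>_def)
  then have "\<Lambda> * m * \<tau> \<le> min (\<beta> / 2) (1 / 2)" using \<Lambda> m by (simp add: pos_le_divide_eq mult.commute)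
  then have \<tau>: "\<Lambda> * m * \<tau> \<le> \<beta> / 2" "\<Lambda> * m * \<tau> \<le> 1 / 2" "\<tau> \<le> \<beta> / 4"
    by (simp_all add: \<tau>_def)
  define Z where "Z = m * (M * (m * \<Lambda>)) + M"
  define w where "w = min (1 / 2) (\<beta> / 4)"
  have Z: "Z > 0" and w: "w > 0" using M m \<Lambda> \<beta> by (auto simp: Z_def w_def intro!: add_nonneg_pos)
  have main: "(\<Sum>x\<in>UNIV. r x * norm (conv_op K b x)) \<le> (2 * Z / w) * (\<Sum>x\<in>UNIV. norm (b x) * (1 - sqrt (r x)))"
    if b: "affine_gradient b" and b1: "(\<Sum>x\<in>UNIV. norm (b x)) = 1"
      and r0: "\<And>x. 0 \<le> r x" and rq: "(\<Sum>x\<in>UNIV. r x) = q"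
      and off: "\<And>y. y \<notin> S \<Longrightarrow> norm (b y) \<le> \<tau>"
      and on: "\<And>y. y \<in> S \<Longrightarrow> \<bar>r y - 1\<bar> \<le> \<tau>" "\<And>y. y \<in> S \<Longrightarrow> \<beta> \<le> norm (b y)"
    for b r
  proof -
    define \<epsilon> where "\<epsilon> = (\<Sum>y\<in>-S. norm (b y))"
    define \<sigma> where "\<sigma> = (\<Sum>y\<in>-S. r y)"
    have \<epsilon>0: "\<epsilon> \<ge> 0" and \<sigma>0: "\<sigma> \<ge> 0" by (simp_all add: \<epsilon>_def \<sigma>_def sum_nonneg r0)
    have split: "(\<Sum>x\<in>UNIV. f x) = (\<Sum>x\<in>S. f x) + (\<Sum>x\<in>-S. f x)" for f :: "_ \<Rightarrow> real"
      using sum.union_disjoint[of S "-S" f] by simp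
    have rS: "(\<Sum>x\<in>S. r x) = q - \<sigma>" using rq unfolding split[of r] by (simp add: \<sigma>_def)
    have "\<epsilon> = (\<Sum>y | level D y \<noteq> t. norm (b y))"
      unfolding \<epsilon>_def S_def by (rule sum.cong) auto
    then obtain c where c: "\<And>y. norm (b y - (if level D y = t then c *s (\<Sum>j\<in>D. axis j 1) else 0)) \<le> \<Lambda> * \<epsilon>"
      using affine_gradient_near_level_set[OF b D, of t] unfolding \<Lambda>_def by auto
    define e where "e y = (if level D y = t then c *s (\<Sum>j\<in>D. axis j 1) else 0 :: complex ^ 'd)" for y
    have be: "norm (b y - e y) \<le> \<Lambda> * \<epsilon>" for y using c[of y] by (simp only: e_def)
    have convS: "norm (conv_op K b x) \<le> M * (m * \<Lambda>) * \<epsilon>" if x: "x \<in> S" for x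
    proof -
      have "conv_op K e x = 0"
        using conv_op_level_set[of D x t K c "\<Sum>j\<in>D. axis j 1"] x K
        by (simp add: S_def e_def[abs_def])
      then have "norm (conv_op K b x) = norm (conv_op K (\<lambda>y. b y - e y) x)"
        by (simp add: conv_op_diff)
      also have "\<dots> \<le> M * (\<Sum>y\<in>UNIV. norm (b y - e y))" by (rule M)
      also have "\<dots> \<le> M * (\<Sum>y\<in>(UNIV :: ('mu mod_ring ^ 'd) set). \<Lambda> * \<epsilon>)"
        using M by (intro mult_left_mono sum_mono be) auto
      finally show ?thesis by (simp add: m_def mult_ac)
    qed
    have conv: "norm (conv_op K b x) \<le> M" for x using M(2)[of b x] b1 by simp
    have "(\<Sum>x\<in>UNIV. r x * norm (conv_op K b x))
        \<le> (\<Sum>x\<in>S. r x * (M * (m * \<Lambda>) * \<epsilon>)) + (\<Sum>x\<in>-S. r x * M)"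
      unfolding split by (intro add_mono sum_mono mult_left_mono convS conv r0)
    also have "\<dots> = (q - \<sigma>) * (M * (m * \<Lambda>) * \<epsilon>) + \<sigma> * M"
      by (simp only: sum_distrib_right[symmetric] rS \<sigma>_def)
    also have "\<dots> \<le> m * (M * (m * \<Lambda>) * \<epsilon>) + \<sigma> * M"
      using M m \<Lambda> \<epsilon>0 \<sigma>0 qm by (intro add_right_mono mult_right_mono) auto
    also have "\<dots> \<le> Z * \<epsilon> + Z * \<sigma>"
      using M m \<Lambda> \<epsilon>0 \<sigma>0 unfolding Z_def by (auto simp: algebra_simps)
    finally have L: "(\<Sum>x\<in>UNIV. r x * norm (conv_op K b x)) \<le> Z * (\<epsilon> + \<sigma>)"
      by (simp add: distrib_left)
    obtain x1 where x1: "x1 \<in> S"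
      using q m by (metis card.empty ex_in_conv of_nat_0 q_def divide_eq_0_iff not_one_le_zero of_nat_eq_0_iff zero_less_card_finite less_irrefl)
    define v where "v = norm (c *s (\<Sum>j\<in>D. axis j 1) :: complex ^ 'd)"
    have vb: "\<bar>norm (b y) - v\<bar> \<le> \<Lambda> * \<epsilon>" if "y \<in> S" for y
      using order_trans[OF norm_triangle_ineq3 be[of y]] that by (simp add: e_def S_def v_def)
    have "\<epsilon> \<le> (\<Sum>y\<in>-S. \<tau>)" unfolding \<epsilon>_def by (intro sum_mono off) auto
    also have "\<dots> \<le> m * \<tau>"
      using \<tau>0 unfolding m_def
      by (simp add: card_mono mult_right_mono del: card_mod_ring_vec CARD_vec)
    finally have "\<Lambda> * \<epsilon> \<le> \<Lambda> * (m * \<tau>)" using \<Lambda> by simp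
    then have "\<Lambda> * \<epsilon> \<le> \<beta> / 2" using \<tau>(1) by (simp only: mult.assoc)
    then have v: "v \<ge> \<beta> / 2" using vb[OF x1] on(2)[OF x1] by linarith
    have "(\<Sum>x\<in>S. v * (1 - r x) - \<Lambda> * \<epsilon> * \<tau>) \<le> (\<Sum>x\<in>S. norm (b x) * (1 - r x))"
    proof (rule sum_mono)
      fix x assume x: "x \<in> S"
      have "(v - norm (b x)) * (1 - r x) \<le> \<bar>v - norm (b x)\<bar> * \<bar>1 - r x\<bar>"
        by (simp flip: abs_mult)
      also have "\<dots> \<le> (\<Lambda> * \<epsilon>) * \<tau>"
        using vb[OF x] on(1)[OF x] \<Lambda> \<epsilon>0 by (intro mult_mono) auto
      finally show "v * (1 - r x) - \<Lambda> * \<epsilon> * \<tau> \<le> norm (b x) * (1 - r x)"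
        by (simp add: algebra_simps)
    qed
    also have "(\<Sum>x\<in>S. v * (1 - r x) - \<Lambda> * \<epsilon> * \<tau>) = v * \<sigma> - q * (\<Lambda> * \<epsilon> * \<tau>)"
      by (simp add: sum_subtractf q rS flip: sum_distrib_left)
    finally have on_le: "v * \<sigma> - q * (\<Lambda> * \<epsilon> * \<tau>) \<le> (\<Sum>x\<in>S. norm (b x) * (1 - r x))" .
    have "(\<Sum>x\<in>-S. norm (b x) - \<tau> * r x) \<le> (\<Sum>x\<in>-S. norm (b x) * (1 - r x))"
      by (rule sum_mono) (use off r0 in \<open>auto simp: right_diff_distrib intro!: mult_right_mono\<close>)
    then have off_le: "\<epsilon> - \<tau> * \<sigma> \<le> (\<Sum>x\<in>-S. norm (b x) * (1 - r x))"
      by (simp add: sum_subtractf \<epsilon>_def \<sigma>_def flip: sum_distrib_left)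
    have "w * (\<epsilon> + \<sigma>) = w * \<epsilon> + w * \<sigma>" by (rule distrib_left)
    also have "\<dots> \<le> 1 / 2 * \<epsilon> + \<beta> / 4 * \<sigma>"
      by (intro add_mono mult_right_mono \<epsilon>0 \<sigma>0) (simp_all add: w_def)
    also have "\<dots> \<le> (v * \<sigma> - q * (\<Lambda> * \<epsilon> * \<tau>)) + (\<epsilon> - \<tau> * \<sigma>)"
    proof -
      have "q * (\<Lambda> * \<epsilon> * \<tau>) \<le> m * (\<Lambda> * \<epsilon> * \<tau>)"
        using qm \<Lambda> \<epsilon>0 \<tau>0 by (intro mult_right_mono) auto
      also have "\<dots> = (\<Lambda> * m * \<tau>) * \<epsilon>" by (simp add: mult_ac)
      also have "\<dots> \<le> 1 / 2 * \<epsilon>" using \<tau> \<epsilon>0 by (intro mult_right_mono)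
      finally have "q * (\<Lambda> * \<epsilon> * \<tau>) \<le> 1 / 2 * \<epsilon>" .
      moreover have "\<beta> / 4 * \<sigma> \<le> (v - \<tau>) * \<sigma>"
        using v \<tau> \<sigma>0 by (intro mult_right_mono) auto
      ultimately show ?thesis by (simp add: algebra_simps)
    qed
    also have "\<dots> \<le> (\<Sum>x\<in>UNIV. norm (b x) * (1 - r x))"
      unfolding split using on_le off_le by linarith
    also have "\<dots> \<le> (\<Sum>x\<in>UNIV. norm (b x) * (2 * (1 - sqrt (r x))))"
      by (intro sum_mono mult_left_mono one_minus_sqrt_ge r0) auto
    also have "\<dots> = 2 * (\<Sum>x\<in>UNIV. norm (b x) * (1 - sqrt (r x)))"
      by (simp only: sum_distrib_left mult.left_commute)
    finally have "\<epsilon> + \<sigma> \<le> 2 / w * (\<Sum>x\<in>UNIV. norm (b x) * (1 - sqrt (r x)))"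
      using w by (simp add: field_simps)
    then have "Z * (\<epsilon> + \<sigma>) \<le> Z * (2 / w * (\<Sum>x\<in>UNIV. norm (b x) * (1 - sqrt (r x))))"
      using Z by (intro mult_left_mono) auto
    with L show ?thesis by (simp add: mult_ac)
  qed
  show ?thesis
    by (intro exI[of _ \<tau>] conjI \<tau>0 exI[of _ "2 * Z / w"] allI impI main)
       (use Z w in \<open>auto simp: S_def q_def m_def\<close>)
qed

text \<open>Where both terms on the right of the local inequality fail to be positive. No cancellation in
  \<open>\<Sum>\<^sub>x b x\<close> means \<open>b = h s\<close> with \<open>h \<ge> 0\<close>, so \<open>h\<close> is a function of some level. With
  \<open>q = m / \<mu>\<close> the size of a level set, \<open>q h \<le> 1\<close>, and
  \<open>2 \<Sum> h (1 - \<surd>r) = q\<^sup>-\<^sup>1 \<Sum> r (1 - q h) + \<Sum> h (1 - \<surd>r)\<^sup>2\<close>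
  is a sum of nonnegative terms. All of them vanish, so \<open>h\<close> lives on one level set and \<open>r = 1\<close> there.\<close>

lemma degenerate_structure:
  fixes b :: "'mu::nontriv mod_ring ^ 'd::finite \<Rightarrow> complex ^ 'd"
  assumes b: "affine_gradient b" and b1: "(\<Sum>x\<in>UNIV. norm (b x)) = 1"
    and flat: "norm (\<Sum>x\<in>UNIV. b x) = 1"
    and r0: "\<And>x. 0 \<le> r x" and rq: "(\<Sum>x\<in>UNIV. r x) = real CARD('mu mod_ring ^ 'd) / real CARD('mu)"
    and X: "(\<Sum>x\<in>UNIV. norm (b x) * (1 - sqrt (r x))) \<le> 0"
  shows "\<exists>D t. D \<noteq> {} \<and> (\<forall>y. level D y \<noteq> t \<longrightarrow> b y = 0) \<and> (\<forall>y. level D y = t \<longrightarrow> r y = 1 \<and> b y \<noteq> 0)"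
proof -
  define s where "s = (\<Sum>x\<in>UNIV. b x)"
  define h where "h x = norm (b x)" for x
  have h0: "h x \<ge> 0" for x by (simp add: h_def)
  have ns: "norm s = 1" using flat by (simp add: s_def)
  have "(\<Sum>x\<in>UNIV. norm (b x) - b x \<bullet> s) = 1 - s \<bullet> s"
    unfolding sum_subtractf b1 by (simp add: s_def inner_sum_left)
  also have "\<dots> = 0" using ns by (simp add: dot_square_norm)
  finally have "\<forall>x\<in>UNIV. norm (b x) - b x \<bullet> s = 0"
  proof (subst (asm) sum_nonneg_eq_0_iff)
    show "0 \<le> norm (b x) - b x \<bullet> s" for x
      using norm_cauchy_schwarz[of "b x" s] ns by simp
  qed auto
  then have bh: "b x = h x *\<^sub>R s" for x
    using norm_cauchy_schwarz_eq[of "b x" s] ns by (simp add: h_def)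
  have "of_real (h (x + axis j 1) - h x) * s $ i = of_real (h (x + axis i 1) - h x) * s $ j" for x i j
  proof -
    have "b (x + axis j 1) $ i - b x $ i = b (x + axis i 1) $ j - b x $ j"
      using b by (simp add: affine_gradient_def)
    then show ?thesis by (simp only: bh vector_scaleR_component) (simp add: scaleR_conv_of_real left_diff_distrib)
  qed
  moreover have "s \<noteq> 0" using ns by auto
  ultimately obtain D where D: "D \<noteq> {}" and lev: "\<And>x y. level D x = level D y \<Longrightarrow> h x = h y"
    using flat_gradient_structure[of h s] by blast
  define q where "q = real CARD('mu mod_ring ^ 'd) / real CARD('mu)"
  have q: "real (card {x :: 'mu mod_ring ^ 'd. level D x = t}) = q" for t
    using card_level_real[OF D, of t] unfolding q_def by (simp only: CARD_mod_ring)
  have q0: "q > 0" by (simp add: q_def)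
  have hsum: "(\<Sum>y | level D y = level D x. h y) = q * h x" for x
  proof -
    have "(\<Sum>y | level D y = level D x. h y) = (\<Sum>y | level D y = level D x. h x)"
      by (rule sum.cong) (auto intro: lev)
    then show ?thesis by (simp add: q)
  qed
  have h1: "(\<Sum>x\<in>UNIV. h x) = 1" using b1 by (simp add: h_def)
  have hq: "q * h x \<le> 1" for x
    unfolding hsum[symmetric] h1[symmetric] by (rule sum_mono2) (auto simp: h0)
  have A: "(\<Sum>x\<in>UNIV. r x * (1 - q * h x)) \<ge> 0"
    by (intro sum_nonneg mult_nonneg_nonneg r0) (simp add: hq)
  have B: "(\<Sum>x\<in>UNIV. h x * (1 - sqrt (r x))\<^sup>2) \<ge> 0"
    by (intro sum_nonneg mult_nonneg_nonneg h0) simp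
  have "2 * (h x * (1 - sqrt (r x))) = h x - h x * r x + h x * (1 - sqrt (r x))\<^sup>2" for x
    using r0[of x] by (simp add: power2_eq_square algebra_simps)
  then have "2 * (\<Sum>x\<in>UNIV. h x * (1 - sqrt (r x)))
     = (\<Sum>x\<in>UNIV. h x) - (\<Sum>x\<in>UNIV. h x * r x) + (\<Sum>x\<in>UNIV. h x * (1 - sqrt (r x))\<^sup>2)"
    by (simp add: sum_distrib_left sum.distrib sum_subtractf)
  moreover have rP: "(\<Sum>x\<in>UNIV. r x * (1 - q * h x)) = q * ((\<Sum>x\<in>UNIV. h x) - (\<Sum>x\<in>UNIV. h x * r x))"
    using rq unfolding h1 q_def[symmetric]
    by (simp add: sum_distrib_left sum_subtractf right_diff_distrib mult_ac)
  moreover have "(\<Sum>x\<in>UNIV. h x) - (\<Sum>x\<in>UNIV. h x * r x) \<ge> 0"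
    using A q0 unfolding rP by (simp add: zero_le_mult_iff)
  moreover have "(\<Sum>x\<in>UNIV. h x * (1 - sqrt (r x))) \<le> 0" using X by (simp add: h_def)
  ultimately have A0: "(\<Sum>x\<in>UNIV. r x * (1 - q * h x)) = 0"
    and B0: "(\<Sum>x\<in>UNIV. h x * (1 - sqrt (r x))\<^sup>2) = 0"
    using B by auto
  have "r x * (1 - q * h x) = 0" for x
    using A0 by (subst (asm) sum_nonneg_eq_0_iff) (auto simp: r0 hq)
  moreover have "h x * (1 - sqrt (r x))\<^sup>2 = 0" for x
    using B0 by (subst (asm) sum_nonneg_eq_0_iff) (auto simp: h0)
  ultimately have rpos: "r x \<noteq> 0 \<Longrightarrow> q * h x = 1" and hpos: "h x \<noteq> 0 \<Longrightarrow> r x = 1" for x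
    by (smt (verit) mult_eq_0_iff power_eq_0_iff real_sqrt_eq_1_iff)+
  obtain x1 where "r x1 \<noteq> 0"
    using rq q0 unfolding q_def[symmetric] by (metis less_irrefl sum.neutral)
  then have x1: "q * h x1 = 1" by (rule rpos)
  define t where "t = level D x1"
  have on: "q * h y = 1" if "level D y = t" for y
    using lev[of y x1] that x1 by (simp add: t_def)
  have off: "h y = 0" if y: "level D y \<noteq> t" for y
  proof -
    have "(\<Sum>z\<in>insert y {z. level D z = t}. h z) \<le> (\<Sum>z\<in>UNIV. h z)"
      by (rule sum_mono2) (auto simp: h0)
    then have "h y + (\<Sum>z | level D z = level D x1. h z) \<le> 1"
      using y by (simp add: h1 t_def)
    then show ?thesis using hsum[of x1] x1 h0[of y] by simp
  qed
  have "b y = 0" if "level D y \<noteq> t" for y using off[OF that] by (simp add: h_def)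
  moreover have "r y = 1 \<and> b y \<noteq> 0" if "level D y = t" for y
    using on[OF that] hpos[of y] by (cases "b y = 0") (auto simp: h_def)
  ultimately show ?thesis using D by blast
qed

lemma compact_uniform_parameter:
  fixes P :: "real \<Rightarrow> 'a::topological_space \<Rightarrow> bool"
  assumes "compact T"
    and loc: "\<And>p. p \<in> T \<Longrightarrow> \<exists>t>0. \<exists>U. open U \<and> p \<in> U \<and> (\<forall>p'\<in>U \<inter> T. P t p')"
    and mono: "\<And>t t' p. p \<in> T \<Longrightarrow> P t p \<Longrightarrow> 0 < t \<Longrightarrow> t \<le> t' \<Longrightarrow> P t' p"
  shows "\<exists>t>0. \<forall>p\<in>T. P t p"
proof -
  obtain t U where tU: "\<And>p. p \<in> T \<Longrightarrow> t p > 0 \<and> open (U p) \<and> p \<in> U p \<and> (\<forall>p'\<in>U p \<inter> T. P (t p) p')"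
    using loc by metis
  obtain C where C: "C \<subseteq> T" "finite C" "T \<subseteq> (\<Union>c\<in>C. U c)"
    by (rule compactE_image[OF \<open>compact T\<close>, of T U]) (use tU in auto)
  define s where "s = Max (insert 1 (t ` C))"
  have s: "s \<ge> t c" if "c \<in> C" for c
    unfolding s_def using that C by (intro Max_ge) auto
  have "s \<ge> 1" unfolding s_def using C by (intro Max_ge) auto
  moreover have "P s p" if p: "p \<in> T" for p
  proof -
    obtain c where "c \<in> C" "p \<in> U c" using C(3) p by auto
    then show ?thesis using tU[of c] C s p by (meson IntI mono subsetD)
  qed
  ultimately show ?thesis by (intro exI[of _ s]) auto
qed

text \<open>Write the right-hand side as \<open>t (X + t Y)\<close>. The inequality for \<open>t\<close> implies the one for every larger
  \<open>t\<close>: the left-hand side is nonnegative, so \<open>X + t Y \<ge> 0\<close>, even though \<open>X\<close> alone may be negative.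
  So by compactness it suffices to find, near each point, some \<open>t\<close> that works. If \<open>X > 0\<close> or \<open>Y > 0\<close> at
  the point, the inequality is strict there for large \<open>t\<close> and persists by continuity; otherwise the
  point is a level-set configuration.\<close>

lemma local_inequality_normalized:
  fixes K :: "'mu::nontriv mod_ring ^ 'd::finite \<Rightarrow> complex ^ 'd"
  assumes K: "\<And>D. (\<Sum>z | level D z = 0. pairing (K z) (\<Sum>j\<in>D. axis j 1)) = 0"
  shows "\<exists>t>0. \<forall>b r. affine_gradient b \<longrightarrow> (\<Sum>x\<in>UNIV. norm (b x)) = 1 \<longrightarrow>
     (\<forall>x. 0 \<le> r x) \<longrightarrow> (\<Sum>x\<in>UNIV. r x) = real CARD('mu mod_ring ^ 'd) / real CARD('mu) \<longrightarrow>
     (\<Sum>x\<in>UNIV. r x * norm (conv_op K b x))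
       \<le> t * ((\<Sum>x\<in>UNIV. norm (b x) * (1 - sqrt (r x))) + t * ((\<Sum>x\<in>UNIV. norm (b x)) - norm (\<Sum>x\<in>UNIV. b x)))"
proof -
  define q where "q = real CARD('mu mod_ring ^ 'd) / real CARD('mu)"
  define L where "L p = (\<Sum>x\<in>UNIV. snd p $ x * norm (conv_op K (vec_nth (fst p)) x))"
    for p :: "((complex ^ 'd) ^ ('mu mod_ring ^ 'd)) \<times> (real ^ ('mu mod_ring ^ 'd))"
  define X where "X p = (\<Sum>x\<in>UNIV. norm (fst p $ x) * (1 - sqrt (snd p $ x)))"
    for p :: "((complex ^ 'd) ^ ('mu mod_ring ^ 'd)) \<times> (real ^ ('mu mod_ring ^ 'd))"
  define Y where "Y p = (\<Sum>x\<in>UNIV. norm (fst p $ x)) - norm (\<Sum>x\<in>UNIV. fst p $ x)"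
    for p :: "((complex ^ 'd) ^ ('mu mod_ring ^ 'd)) \<times> (real ^ ('mu mod_ring ^ 'd))"
  define T where "T = {p :: ((complex ^ 'd) ^ ('mu mod_ring ^ 'd)) \<times> (real ^ ('mu mod_ring ^ 'd)).
      affine_gradient (vec_nth (fst p)) \<and> (\<Sum>x\<in>UNIV. norm (fst p $ x)) = 1 \<and>
      (\<forall>x. 0 \<le> snd p $ x) \<and> (\<Sum>x\<in>UNIV. snd p $ x) = q}"
  have L0: "L p \<ge> 0" if "p \<in> T" for p
    using that by (auto simp: L_def T_def intro!: sum_nonneg)
  have Y0: "Y p \<ge> 0" for p by (simp add: Y_def norm_sum)
  have cont: "continuous_on UNIV L" "continuous_on UNIV X" "continuous_on UNIV Y"
    unfolding L_def X_def Y_def conv_op_def pairing_def by (intro continuous_intros)+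
  have "closed T"
    unfolding T_def affine_gradient_def
    by (intro closed_Collect_conj closed_Collect_all closed_Collect_eq closed_Collect_le continuous_intros)
  moreover have "bounded T"
  proof (rule boundedI)
    fix p assume p: "p \<in> T"
    have "norm (fst p) \<le> (\<Sum>x\<in>UNIV. norm (fst p $ x))"
      unfolding norm_vec_def by (rule L2_set_le_sum) simp
    moreover have "norm (snd p) \<le> (\<Sum>x\<in>UNIV. norm (snd p $ x))"
      unfolding norm_vec_def by (rule L2_set_le_sum) simp
    moreover have "(\<Sum>x\<in>UNIV. norm (snd p $ x)) = q" using p by (simp add: T_def)
    ultimately show "norm p \<le> 1 + q"
      using norm_Pair_le[of "fst p" "snd p"] p by (simp add: T_def)
  qed
  ultimately have T: "compact T" by (simp add: compact_eq_bounded_closed)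
  have "\<exists>t>0. \<forall>p\<in>T. L p \<le> t * (X p + t * Y p)"
  proof (rule compact_uniform_parameter[OF T])
    fix t t' :: real and p
    assume p: "p \<in> T" and le: "L p \<le> t * (X p + t * Y p)" and t: "0 < t" "t \<le> t'"
    have "0 \<le> t * (X p + t * Y p)" using le L0[OF p] by linarith
    then have "0 \<le> X p + t * Y p" using t by (simp add: zero_le_mult_iff)
    moreover have "t * Y p \<le> t' * Y p" using t Y0[of p] by (intro mult_right_mono)
    ultimately have "t * (X p + t * Y p) \<le> t' * (X p + t' * Y p)"
      using t by (intro mult_mono) auto
    with le show "L p \<le> t' * (X p + t' * Y p)" by linarith
  next
    fix p assume p: "p \<in> T"
    show "\<exists>t>0. \<exists>U. open U \<and> p \<in> U \<and> (\<forall>p'\<in>U \<inter> T. L p' \<le> t * (X p' + t * Y p'))"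
    proof (cases "X p > 0 \<or> Y p > 0")
      case True
      have "\<exists>t>0. L p < t * (X p + t * Y p)"
      proof (cases "Y p > 0")
        case Y: True
        define t where "t = (L p + 1 + \<bar>X p\<bar>) / Y p + 1"
        have t1: "t \<ge> 1" using Y L0[OF p] by (simp add: t_def)
        have "t * Y p = L p + 1 + \<bar>X p\<bar> + Y p" using Y by (simp add: t_def field_simps)
        then have "L p + 1 \<le> 1 * (X p + t * Y p)" using Y by simp
        also have "\<dots> \<le> t * (X p + t * Y p)"
          using t1 \<open>L p + 1 \<le> 1 * (X p + t * Y p)\<close> L0[OF p] by (intro mult_right_mono) auto
        finally show ?thesis using t1 by (intro exI[of _ t]) auto
      next
        case False
        then have "X p > 0" "Y p = 0" using True Y0[of p] by auto
        then show ?thesis using L0[OF p] by (intro exI[of _ "(L p + 1) / X p"]) auto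
      qed
      then obtain t where t: "t > 0" "L p < t * (X p + t * Y p)" by blast
      have "open {p. L p < t * (X p + t * Y p)}"
        by (intro open_Collect_less continuous_intros cont)
      then show ?thesis using t by (intro exI[of _ t] conjI exI[of _ "{p. L p < t * (X p + t * Y p)}"]) auto
    next
      case False
      then have "X p \<le> 0" "Y p = 0" using Y0[of p] by auto
      then obtain D t where D: "D \<noteq> {}" and off: "\<And>y. level D y \<noteq> t \<Longrightarrow> fst p $ y = 0"
        and on: "\<And>y. level D y = t \<Longrightarrow> snd p $ y = 1 \<and> fst p $ y \<noteq> 0"
        using degenerate_structure[of "vec_nth (fst p)" "vec_nth (snd p)"] p
        unfolding T_def X_def Y_def q_def by auto
      define S where "S = {x :: 'mu mod_ring ^ 'd. level D x = t}"
      define \<beta> where "\<beta> = Min (insert 1 ((\<lambda>y. norm (fst p $ y) / 2) ` S))"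
      have \<beta>: "\<beta> > 0" unfolding \<beta>_def using on by (subst Min_gr_iff) (auto simp: S_def)
      have \<beta>': "\<beta> < norm (fst p $ y)" if "level D y = t" for y
      proof -
        have "\<beta> \<le> norm (fst p $ y) / 2"
          unfolding \<beta>_def by (rule Min_le) (use that in \<open>auto simp: S_def\<close>)
        also have "\<dots> < norm (fst p $ y)" using on[OF that] by simp
        finally show ?thesis .
      qed
      obtain \<tau> s where \<tau>: "\<tau> > 0" and s: "s > 0" and loc: "\<And>b r. affine_gradient b \<Longrightarrow>
          (\<Sum>x\<in>UNIV. norm (b x)) = 1 \<Longrightarrow> (\<And>x. 0 \<le> r x) \<Longrightarrow> (\<Sum>x\<in>UNIV. r x) = q \<Longrightarrow>
          (\<And>y. level D y \<noteq> t \<Longrightarrow> norm (b y) \<le> \<tau>) \<Longrightarrow>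
          (\<And>y. level D y = t \<Longrightarrow> \<bar>r y - 1\<bar> \<le> \<tau> \<and> \<beta> \<le> norm (b y)) \<Longrightarrow>
          (\<Sum>x\<in>UNIV. r x * norm (conv_op K b x)) \<le> s * (\<Sum>x\<in>UNIV. norm (b x) * (1 - sqrt (r x)))"
        using local_bound_near_level_set[OF D \<beta> K, of t] unfolding q_def by blast
      define U where "U = (\<Inter>y. {p'. norm (fst p' $ y - fst p $ y) < \<tau>}) \<inter> (\<Inter>y. {p'. \<bar>snd p' $ y - snd p $ y\<bar> < \<tau>})
         \<inter> (\<Inter>y\<in>S. {p'. \<beta> < norm (fst p' $ y)})"
      have "open U"
        unfolding U_def
        by (intro open_Int open_INT ballI open_Collect_less continuous_intros) auto
      moreover have "p \<in> U" using \<tau> \<beta>' by (auto simp: U_def S_def)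
      moreover have "L p' \<le> s * (X p' + s * Y p')" if p': "p' \<in> U \<inter> T" for p'
      proof -
        have "L p' \<le> s * X p'"
          unfolding L_def X_def
        proof (rule loc)
          show "affine_gradient (vec_nth (fst p'))" "(\<Sum>x\<in>UNIV. norm (fst p' $ x)) = 1"
            "\<And>x. 0 \<le> snd p' $ x" "(\<Sum>x\<in>UNIV. snd p' $ x) = q"
            using p' by (auto simp: T_def)
          show "norm (fst p' $ y) \<le> \<tau>" if "level D y \<noteq> t" for y
            using p' off[OF that] by (auto simp: U_def less_imp_le dest: spec[of _ y])
          show "\<bar>snd p' $ y - 1\<bar> \<le> \<tau> \<and> \<beta> \<le> norm (fst p' $ y)" if "level D y = t" for y
            using p' on[OF that] that by (auto simp: U_def S_def less_imp_le dest: spec[of _ y])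
        qed
        also have "\<dots> \<le> s * (X p' + s * Y p')" using s Y0[of p'] by (intro mult_left_mono) auto
        finally show ?thesis .
      qed
      ultimately show ?thesis using s by blast
    qed
  qed
  then obtain t where t: "t > 0" and main: "\<And>p. p \<in> T \<Longrightarrow> L p \<le> t * (X p + t * Y p)" by blast
  show ?thesis
  proof (intro exI[of _ t] conjI t allI impI)
    fix b :: "'mu mod_ring ^ 'd \<Rightarrow> complex ^ 'd" and r :: "'mu mod_ring ^ 'd \<Rightarrow> real"
    assume "affine_gradient b" "(\<Sum>x\<in>UNIV. norm (b x)) = 1" "\<forall>x. 0 \<le> r x"
      "(\<Sum>x\<in>UNIV. r x) = real CARD('mu mod_ring ^ 'd) / real CARD('mu)"
    moreover have "vec_nth (vec_lambda b) = b" by (simp add: fun_eq_iff)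
    ultimately have "(vec_lambda b, vec_lambda r) \<in> T"
      unfolding T_def q_def by simp
    from main[OF this] \<open>vec_nth (vec_lambda b) = b\<close>
    show "(\<Sum>x\<in>UNIV. r x * norm (conv_op K b x))
       \<le> t * ((\<Sum>x\<in>UNIV. norm (b x) * (1 - sqrt (r x))) + t * ((\<Sum>x\<in>UNIV. norm (b x)) - norm (\<Sum>x\<in>UNIV. b x)))"
      unfolding L_def X_def Y_def by simp
  qed
qed

lemma affine_gradient_scale:
  "affine_gradient b \<Longrightarrow> affine_gradient (\<lambda>x. c *\<^sub>R b x)"
  unfolding affine_gradient_def
  by (simp flip: scaleR_diff_right scaleR_sum_right)

lemma conv_op_scaleR: "conv_op K (\<lambda>x. c *\<^sub>R g x) x = c *\<^sub>R conv_op K g x"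
  by (simp add: conv_op_def pairing_def scaleR_sum_right)

text \<open>The inequality is homogeneous of degree \<open>1\<close> in \<open>b\<close>. Rescaling \<open>r\<close> to \<open>\<rho> = 1\<close> multiplies the
  normalized right-hand side by \<open>\<rho>\<close>; since that side is nonnegative and \<open>\<rho> \<le> \<surd>\<rho>\<close>, the factor can be
  replaced by \<open>\<surd>\<rho>\<close>, which is the one that turns \<open>1 - \<surd>(r / \<rho>)\<close> into \<open>\<surd>\<rho> - \<surd>r\<close>.\<close>

lemma local_inequality:
  fixes K :: "'mu::nontriv mod_ring ^ 'd::finite \<Rightarrow> complex ^ 'd"
  assumes K: "\<And>D. (\<Sum>z | level D z = 0. pairing (K z) (\<Sum>j\<in>D. axis j 1)) = 0"
  shows "\<exists>t>0. \<forall>b r \<rho>. affine_gradient b \<longrightarrow> (\<forall>x. 0 \<le> r x) \<longrightarrow>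
     (\<Sum>x\<in>UNIV. r x) = real CARD('mu mod_ring ^ 'd) / real CARD('mu) * \<rho> \<longrightarrow> \<rho> \<le> 1 \<longrightarrow>
     (\<Sum>x\<in>UNIV. r x * norm (conv_op K b x))
       \<le> t * (\<Sum>x\<in>UNIV. norm (b x) * (sqrt \<rho> - sqrt (r x))) + t\<^sup>2 * ((\<Sum>x\<in>UNIV. norm (b x)) - norm (\<Sum>x\<in>UNIV. b x))"
proof -
  obtain t where t: "t > 0" and norm_ineq: "\<And>b r. affine_gradient b \<Longrightarrow> (\<Sum>x\<in>UNIV. norm (b x)) = 1 \<Longrightarrow>
     (\<And>x. 0 \<le> r x) \<Longrightarrow> (\<Sum>x\<in>UNIV. r x) = real CARD('mu mod_ring ^ 'd) / real CARD('mu) \<Longrightarrow>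
     (\<Sum>x\<in>UNIV. r x * norm (conv_op K b x))
       \<le> t * ((\<Sum>x\<in>UNIV. norm (b x) * (1 - sqrt (r x))) + t * ((\<Sum>x\<in>UNIV. norm (b x)) - norm (\<Sum>x\<in>UNIV. b x)))"
    using local_inequality_normalized[OF K] by blast
  have main: "(\<Sum>x\<in>UNIV. r x * norm (conv_op K b x))
       \<le> t * (\<Sum>x\<in>UNIV. norm (b x) * (sqrt \<rho> - sqrt (r x))) + t\<^sup>2 * ((\<Sum>x\<in>UNIV. norm (b x)) - norm (\<Sum>x\<in>UNIV. b x))"
    if b: "affine_gradient b" and r0: "\<And>x. 0 \<le> r x"
      and rq: "(\<Sum>x\<in>UNIV. r x) = real CARD('mu mod_ring ^ 'd) / real CARD('mu) * \<rho>" and \<rho>1: "\<rho> \<le> 1"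
    for b r \<rho>
  proof -
    define q where "q = real CARD('mu mod_ring ^ 'd) / real CARD('mu)"
    have q0: "q > 0" by (simp add: q_def)
    define Y where "Y = (\<Sum>x\<in>UNIV. norm (b x)) - norm (\<Sum>x\<in>UNIV. b x)"
    have Y0: "Y \<ge> 0" by (simp add: Y_def norm_sum)
    have "q * \<rho> \<ge> 0" using rq sum_nonneg[of UNIV r] r0 by (simp only: q_def)
    then have \<rho>0: "\<rho> \<ge> 0" using q0 by (simp add: zero_le_mult_iff)
    define B where "B = (\<Sum>x\<in>UNIV. norm (b x))"
    have B0: "B \<ge> 0" by (simp add: B_def sum_nonneg)
    consider "\<rho> = 0" | "B = 0" | "\<rho> > 0" "B > 0" using \<rho>0 B0 by linarith
    then show ?thesis
    proof cases
      case 1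
      then have "r x = 0" for x using rq r0 by (simp add: sum_nonneg_eq_0_iff)
      then show ?thesis using 1 Y0 by (simp add: Y_def)
    next
      case 2
      then have "b x = 0" for x unfolding B_def by (simp add: sum_nonneg_eq_0_iff)
      then have "b = (\<lambda>x. 0)" by auto
      then show ?thesis by simp
    next
      case 3
      define b' where "b' x = (1 / B) *\<^sub>R b x" for x
      define r' where "r' x = r x / \<rho>" for x
      have nb': "norm (b' x) = norm (b x) / B" for x using 3 by (simp add: b'_def)
      have sb': "norm (\<Sum>x\<in>UNIV. b' x) = norm (\<Sum>x\<in>UNIV. b x) / B"
        using 3 by (simp add: b'_def flip: scaleR_sum_right)
      have c': "norm (conv_op K b' x) = norm (conv_op K b x) / B" for x
        using 3 unfolding b'_def conv_op_scaleR by simp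
      have "(\<Sum>x\<in>UNIV. norm (b' x)) = 1"
        using 3 by (simp add: nb' B_def[symmetric] flip: sum_divide_distrib)
      moreover have "(\<Sum>x\<in>UNIV. r' x) = q"
        using 3 rq by (simp add: r'_def q_def flip: sum_divide_distrib)
      ultimately have "(\<Sum>x\<in>UNIV. r' x * norm (conv_op K b' x))
         \<le> t * ((\<Sum>x\<in>UNIV. norm (b' x) * (1 - sqrt (r' x))) + t * ((\<Sum>x\<in>UNIV. norm (b' x)) - norm (\<Sum>x\<in>UNIV. b' x)))"
        by (intro norm_ineq) (use 3 r0 b in \<open>auto simp: q_def r'_def b'_def[abs_def] intro: affine_gradient_scale\<close>)
      define Z where "Z = t * ((\<Sum>x\<in>UNIV. norm (b x) * (1 - sqrt (r x / \<rho>))) + t * Y)"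
      have e1: "(\<Sum>x\<in>UNIV. r' x * norm (conv_op K b' x)) = (\<Sum>x\<in>UNIV. r x * norm (conv_op K b x)) / \<rho> / B"
        by (simp add: c' r'_def sum_divide_distrib)
      have e2: "(\<Sum>x\<in>UNIV. norm (b' x) * (1 - sqrt (r' x))) = (\<Sum>x\<in>UNIV. norm (b x) * (1 - sqrt (r x / \<rho>))) / B"
        by (simp add: nb' r'_def sum_divide_distrib)
      have e3: "(\<Sum>x\<in>UNIV. norm (b' x)) - norm (\<Sum>x\<in>UNIV. b' x) = Y / B"
        by (simp add: nb' sb' Y_def diff_divide_distrib sum_divide_distrib)
      have "(\<Sum>x\<in>UNIV. r x * norm (conv_op K b x)) / \<rho> / B \<le> Z / B"
        using \<open>(\<Sum>x\<in>UNIV. r' x * norm (conv_op K b' x)) \<le> _\<close> unfolding e1 e2 e3 Z_def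
        by (simp only: add_divide_distrib times_divide_eq_right[symmetric])
      then have le: "(\<Sum>x\<in>UNIV. r x * norm (conv_op K b x)) \<le> \<rho> * Z"
        using 3 by (simp add: divide_le_cancel pos_divide_le_eq mult.commute)
      have "0 \<le> (\<Sum>x\<in>UNIV. r x * norm (conv_op K b x))"
        by (intro sum_nonneg mult_nonneg_nonneg r0) simp
      with le have "0 \<le> \<rho> * Z" by linarith
      then have Z0: "Z \<ge> 0" using 3 by (simp add: zero_le_mult_iff)
      have "\<rho> \<le> sqrt \<rho>" using \<rho>0 \<rho>1 by (simp add: real_le_rsqrt power2_eq_square mult_left_le)
      then have "\<rho> * Z \<le> sqrt \<rho> * Z" using Z0 by (rule mult_right_mono)
      also have "\<dots> = t * (\<Sum>x\<in>UNIV. sqrt \<rho> * (norm (b x) * (1 - sqrt (r x / \<rho>)))) + t\<^sup>2 * (sqrt \<rho> * Y)"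
        unfolding Z_def by (simp add: algebra_simps power2_eq_square sum_distrib_left)
      also have "(\<Sum>x\<in>UNIV. sqrt \<rho> * (norm (b x) * (1 - sqrt (r x / \<rho>)))) = (\<Sum>x\<in>UNIV. norm (b x) * (sqrt \<rho> - sqrt (r x)))"
        using 3 by (intro sum.cong) (auto simp: real_sqrt_divide field_simps)
      also have "t\<^sup>2 * (sqrt \<rho> * Y) \<le> t\<^sup>2 * (1 * Y)"
        using \<rho>0 \<rho>1 Y0 by (intro mult_left_mono mult_right_mono) auto
      finally show ?thesis using le unfolding Y_def by simp
    qed
  qed
  show ?thesis
    by (intro exI[of _ t] conjI t allI impI main) auto
qed

section \<open>Atoms and functions of finitely many digits\<close>

definition cylinder :: "nat \<Rightarrow> (nat \<Rightarrow> 'x) \<Rightarrow> (nat \<Rightarrow> 'x) set" where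
  "cylinder n w = {\<gamma>. \<forall>i<n. \<gamma> i = w i}"

lemma atoms_eq: "atoms n = range (cylinder n)"
  by (simp add: atoms_def cylinder_def[abs_def])

lemma cylinder_in_atoms [simp]: "cylinder n w \<in> atoms n"
  by (simp add: atoms_eq)

lemma in_cylinder_self [simp]: "w \<in> cylinder n w"
  by (simp add: cylinder_def)

lemma cylinder_eq_iff: "cylinder n w = cylinder n w' \<longleftrightarrow> (\<forall>i<n. w i = w' i)"
  by (auto simp: cylinder_def set_eq_iff)

lemma atom_eq_cylinder: "\<omega> \<in> atoms n \<Longrightarrow> \<gamma> \<in> \<omega> \<Longrightarrow> \<omega> = cylinder n \<gamma>"
  by (auto simp: atoms_eq cylinder_eq_iff) (auto simp: cylinder_def)

lemma atom_nonempty: "\<omega> \<in> atoms n \<Longrightarrow> \<exists>\<gamma>. \<gamma> \<in> \<omega>"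
  by (auto simp: atoms_eq intro: in_cylinder_self)

lemma kid_cylinder: "kid n (cylinder n w) x = cylinder (Suc n) (w(n := x))"
  by (auto simp: kid_def cylinder_def less_Suc_eq)

lemma kid_in_atoms: "\<omega> \<in> atoms n \<Longrightarrow> kid n \<omega> x \<in> atoms (Suc n)"
  by (auto simp: atoms_eq kid_cylinder)

lemma atoms_0: "atoms 0 = {UNIV}"
  by (auto simp: atoms_def)

lemma bij_betw_kid:
  "bij_betw (\<lambda>(\<omega>, x). kid n \<omega> x) (atoms n \<times> UNIV) (atoms (Suc n) :: (nat \<Rightarrow> 'x) set set)"
proof (rule bij_betw_imageI)
  show "inj_on (\<lambda>(\<omega>, x). kid n \<omega> x) (atoms n \<times> UNIV :: ((nat \<Rightarrow> 'x) set \<times> 'x) set)"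
  proof (rule inj_onI)
    fix p p' :: "(nat \<Rightarrow> 'x) set \<times> 'x"
    assume p: "p \<in> atoms n \<times> UNIV" "p' \<in> atoms n \<times> UNIV"
      "(case p of (\<omega>, x) \<Rightarrow> kid n \<omega> x) = (case p' of (\<omega>, x) \<Rightarrow> kid n \<omega> x)"
    obtain \<omega> x \<omega>' x' where pp: "p = (\<omega>, x)" "p' = (\<omega>', x')" by fastforce
    have \<omega>: "\<omega> \<in> atoms n" "\<omega>' \<in> atoms n" and eq: "kid n \<omega> x = kid n \<omega>' x'"
      using p by (auto simp: pp)
    obtain \<gamma> where "\<gamma> \<in> kid n \<omega> x" using \<omega> kid_in_atoms atom_nonempty by metis
    then have \<gamma>: "\<gamma> \<in> \<omega>" "\<gamma> n = x" "\<gamma> \<in> \<omega>'" "\<gamma> n = x'"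
      unfolding atomize_conj using eq by (auto simp: kid_def set_eq_iff)
    have "\<omega> = cylinder n \<gamma>" "\<omega>' = cylinder n \<gamma>"
      using \<omega> \<gamma> by (intro atom_eq_cylinder; simp)+
    with \<gamma> show "p = p'" by (simp add: pp)
  qed
  show "(\<lambda>(\<omega>, x). kid n \<omega> x) ` (atoms n \<times> UNIV) = (atoms (Suc n) :: (nat \<Rightarrow> 'x) set set)"
  proof (intro equalityI subsetI)
    fix \<omega>' :: "(nat \<Rightarrow> 'x) set" assume "\<omega>' \<in> atoms (Suc n)"
    then obtain w where "\<omega>' = cylinder (Suc n) w" by (auto simp: atoms_eq)
    then have "\<omega>' = kid n (cylinder n w) (w n)" by (simp add: kid_cylinder)
    then show "\<omega>' \<in> (\<lambda>(\<omega>, x). kid n \<omega> x) ` (atoms n \<times> UNIV)"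
      by (intro image_eqI[of _ _ "(cylinder n w, w n)"]) auto
  qed (auto simp: kid_in_atoms)
qed

lemma sum_atoms_Suc:
  "(\<Sum>\<omega>\<in>atoms (Suc n). f \<omega>) = (\<Sum>\<omega>\<in>atoms n. \<Sum>x\<in>UNIV. f (kid n \<omega> x))"
  for f :: "(nat \<Rightarrow> 'x) set \<Rightarrow> 'b::comm_monoid_add"
  by (subst sum.reindex_bij_betw[OF bij_betw_kid, symmetric])
     (simp add: sum.cartesian_product case_prod_unfold)

lemma finite_atoms [simp]: "finite (atoms n :: (nat \<Rightarrow> 'x::finite) set set)"
proof (induction n)
  case (Suc n)
  then show ?case
    using bij_betw_finite[OF bij_betw_kid[where n = n and 'x = 'x]] by simp
qed (simp add: atoms_0)

lemma atom_in_tree_borel [simp]: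
  assumes "\<omega> \<in> (atoms n :: (nat \<Rightarrow> 'x::finite) set set)"
  shows "\<omega> \<in> sets tree_borel"
proof -
  obtain w where "\<omega> = {\<gamma>. \<forall>i<n. \<gamma> i = w i}" using assms by (auto simp: atoms_def)
  then have "\<omega> \<in> sets tree_prob"
    unfolding tree_prob_def by (auto simp: atom_eq_prod_emb sets_uniform_count_measure
        intro!: sets_PiM_I)
  then show ?thesis by (simp add: sets_tree_prob)
qed

lemma measure_kids:
  fixes \<nu> :: "(nat \<Rightarrow> 'x::finite) measure"
  assumes \<nu>: "sets \<nu> = sets tree_borel" "finite_measure \<nu>" and \<omega>: "\<omega> \<in> atoms n"
  shows "(\<Sum>x\<in>UNIV. measure \<nu> (kid n \<omega> x)) = measure \<nu> \<omega>"
proof -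
  interpret finite_measure \<nu> by fact
  have "\<omega> = (\<Union>x. kid n \<omega> x)" by (auto simp: kid_def)
  also have "measure \<nu> \<dots> = (\<Sum>x\<in>UNIV. measure \<nu> (kid n \<omega> x))"
    by (rule finite_measure_finite_Union)
       (auto simp: \<nu> disjoint_family_on_def kid_def intro!: atom_in_tree_borel[OF kid_in_atoms[OF \<omega>], unfolded kid_def])
  finally show ?thesis by simp
qed

text \<open>For a finite set of digits this is measurability with respect to \<open>tree_filtration n\<close>, in a form
  that does not involve a \<open>\<sigma>\<close>-algebra on the range.\<close>

definition depends_on_digits :: "nat \<Rightarrow> ((nat \<Rightarrow> 'x) \<Rightarrow> 'b) \<Rightarrow> bool" where
  "depends_on_digits n f \<longleftrightarrow> (\<forall>\<gamma> \<gamma>'. (\<forall>i<n. \<gamma> i = \<gamma>' i) \<longrightarrow> f \<gamma> = f \<gamma>')"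

lemma depends_on_digits_mono: "depends_on_digits n f \<Longrightarrow> n \<le> k \<Longrightarrow> depends_on_digits k f"
  by (auto simp: depends_on_digits_def)

lemma depends_on_digits_value_on:
  "depends_on_digits n f \<Longrightarrow> \<omega> \<in> atoms n \<Longrightarrow> \<gamma> \<in> \<omega> \<Longrightarrow> value_on f \<omega> = f \<gamma>"
  unfolding value_on_def
  by (rule the_equality) (auto simp: depends_on_digits_def atoms_def)

lemma sets_tree_filtration: "sets (tree_filtration n) = sigma_sets UNIV (atoms n)"
  by (simp add: tree_filtration_def)

lemma space_tree_filtration [simp]: "space (tree_filtration n) = UNIV"
  by (simp add: tree_filtration_def)

lemma tree_filtration_saturated:
  assumes "A \<in> sets (tree_filtration n)" and "\<forall>i<n. \<gamma> i = \<gamma>' i"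
  shows "\<gamma> \<in> A \<longleftrightarrow> \<gamma>' \<in> A"
  using assms(1) unfolding sets_tree_filtration
proof (induction rule: sigma_sets.induct)
  case (Basic A)
  then show ?case using assms(2) by (auto simp: atoms_def)
qed auto

lemma measurable_depends_on_digits:
  fixes f :: "(nat \<Rightarrow> 'x) \<Rightarrow> 'b::t1_space"
  assumes "f \<in> borel_measurable (tree_filtration n)"
  shows "depends_on_digits n f"
  unfolding depends_on_digits_def
proof (intro allI impI)
  fix \<gamma> \<gamma>' :: "nat \<Rightarrow> 'x" assume *: "\<forall>i<n. \<gamma> i = \<gamma>' i"
  have "f -` {f \<gamma>} \<inter> space (tree_filtration n) \<in> sets (tree_filtration n)"
    by (rule measurable_sets[OF assms]) simp
  from tree_filtration_saturated[OF this *] show "f \<gamma> = f \<gamma>'" by simp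
qed

lemma sum_atoms_indicator:
  fixes f :: "(nat \<Rightarrow> 'x::finite) set \<Rightarrow> 'b::semiring_1"
  shows "(\<Sum>\<omega>\<in>atoms n. f \<omega> * indicator \<omega> \<gamma>) = f (cylinder n \<gamma>)"
proof -
  have "(\<Sum>\<omega>\<in>atoms n. f \<omega> * indicator \<omega> \<gamma>) = (\<Sum>\<omega>\<in>atoms n. if \<omega> = cylinder n \<gamma> then f \<omega> else 0)"
    by (rule sum.cong) (auto simp: indicator_def dest: atom_eq_cylinder)
  then show ?thesis by simp
qed

lemma nn_integral_depends_on_digits:
  fixes M :: "(nat \<Rightarrow> 'x::finite) measure"
  assumes M: "sets M = sets tree_borel" and f: "depends_on_digits n f"
  shows "(\<integral>\<^sup>+\<gamma>. f \<gamma> \<partial>M) = (\<Sum>\<omega>\<in>atoms n. value_on f \<omega> * emeasure M \<omega>)"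
proof -
  have "(\<integral>\<^sup>+\<gamma>. f \<gamma> \<partial>M) = (\<integral>\<^sup>+\<gamma>. (\<Sum>\<omega>\<in>atoms n. value_on f \<omega> * indicator \<omega> \<gamma>) \<partial>M)"
    by (simp add: sum_atoms_indicator depends_on_digits_value_on[OF f cylinder_in_atoms in_cylinder_self])
  also have "\<dots> = (\<Sum>\<omega>\<in>atoms n. \<integral>\<^sup>+\<gamma>. value_on f \<omega> * indicator \<omega> \<gamma> \<partial>M)"
    by (rule nn_integral_sum) (auto simp: M intro!: borel_measurable_times_ennreal borel_measurable_indicator)
  also have "\<dots> = (\<Sum>\<omega>\<in>atoms n. value_on f \<omega> * emeasure M \<omega>)"
    by (rule sum.cong) (auto simp: M nn_integral_cmult_indicator)
  finally show ?thesis .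
qed

lemma mart_diff_eq:
  assumes F: "depends_on_digits n (F n)" "depends_on_digits (Suc n) (F (Suc n))"
    and \<omega>: "\<omega> \<in> atoms n"
  shows "mart_diff F n \<omega> x = value_on (F (Suc n)) (kid n \<omega> x) - value_on (F n) \<omega>"
proof -
  obtain \<gamma> where \<gamma>: "\<gamma> \<in> kid n \<omega> x" using \<omega> kid_in_atoms atom_nonempty by metis
  have "depends_on_digits (Suc n) (\<lambda>\<gamma>. F (Suc n) \<gamma> - F n \<gamma>)"
    using F unfolding depends_on_digits_def by (metis less_SucI)
  from depends_on_digits_value_on[OF this kid_in_atoms[OF \<omega>] \<gamma>]
  have "mart_diff F n \<omega> x = F (Suc n) \<gamma> - F n \<gamma>" by (simp add: mart_diff_def)
  moreover have "\<gamma> \<in> \<omega>" using \<gamma> by (simp add: kid_def)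
  ultimately show ?thesis
    using depends_on_digits_value_on[OF F(1) \<omega>] depends_on_digits_value_on[OF F(2) kid_in_atoms[OF \<omega>] \<gamma>] by metis
qed

lemma mart_diff_stationary:
  assumes "F (Suc n) = F n" and \<omega>: "\<omega> \<in> atoms n"
  shows "mart_diff F n \<omega> = (\<lambda>x. 0)"
proof
  fix x
  obtain \<gamma> where \<gamma>: "\<gamma> \<in> kid n \<omega> x" using \<omega> kid_in_atoms atom_nonempty by metis
  show "mart_diff F n \<omega> x = 0"
    unfolding mart_diff_def value_on_def
    by (rule the_equality) (use assms(1) \<gamma> in auto)
qed

lemma frac_integral_eq_sum:
  fixes F :: "nat \<Rightarrow> (nat \<Rightarrow> 'x::finite) \<Rightarrow> complex ^ 'd"
  assumes F: "\<And>n. n \<ge> N \<Longrightarrow> F n = F N" and \<phi>: "\<And>x. \<phi> (\<lambda>x. 0) x = 0"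
  shows "frac_integral \<alpha> \<phi> F \<gamma> = (\<Sum>n<N. of_real (real CARD('x) powr (- \<alpha> * real n)) *
        (\<Sum>\<omega>\<in>atoms n. \<Sum>x\<in>UNIV. \<phi> (mart_diff F n \<omega>) x * indicator (kid n \<omega> x) \<gamma>))"
  unfolding frac_integral_def
proof (rule suminf_finite)
  fix n assume "n \<notin> {..<N}"
  then have "F (Suc n) = F n" using F[of n] F[of "Suc n"] by simp
  then show "of_real (real CARD('x) powr (- \<alpha> * real n)) *
        (\<Sum>\<omega>\<in>atoms n. \<Sum>x\<in>UNIV. \<phi> (mart_diff F n \<omega>) x * indicator (kid n \<omega> x) \<gamma>) = 0"
    by (simp add: mart_diff_stationary \<phi>)
qed simp

lemma ennreal_sum3:
  assumes "\<And>i j k. 0 \<le> f i j k"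
  shows "ennreal (\<Sum>i\<in>A. \<Sum>j\<in>B i. \<Sum>k\<in>C. f i j k) = (\<Sum>i\<in>A. \<Sum>j\<in>B i. \<Sum>k\<in>C. ennreal (f i j k))"
  using assms by (simp add: sum_nonneg)

lemma nn_integral_frac_integral_le:
  fixes F :: "nat \<Rightarrow> (nat \<Rightarrow> 'x::finite) \<Rightarrow> complex ^ 'd"
  assumes F: "\<And>n. n \<ge> N \<Longrightarrow> F n = F N" and \<phi>: "\<And>x. \<phi> (\<lambda>x. 0) x = 0"
    and \<nu>: "sets \<nu> = sets tree_borel" "finite_measure \<nu>"
  shows "(\<integral>\<^sup>+\<gamma>. ennreal (norm (frac_integral \<alpha> \<phi> F \<gamma>)) \<partial>\<nu>)
    \<le> ennreal (\<Sum>n<N. \<Sum>\<omega>\<in>atoms n. \<Sum>x\<in>UNIV.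
          real CARD('x) powr (- \<alpha> * real n) * norm (\<phi> (mart_diff F n \<omega>) x) * measure \<nu> (kid n \<omega> x))"
proof -
  interpret finite_measure \<nu> by fact
  let ?c = "\<lambda>n \<omega> x. real CARD('x) powr (- \<alpha> * real n) * norm (\<phi> (mart_diff F n \<omega>) x)"
  have kid: "kid n \<omega> x \<in> sets \<nu>" if "\<omega> \<in> atoms n" for n x and \<omega> :: "(nat \<Rightarrow> 'x) set"
    using atom_in_tree_borel[OF kid_in_atoms[OF that]] by (simp add: \<nu>)
  have meas: "(\<lambda>\<gamma>. ennreal c * indicator (kid n \<omega> x) \<gamma>) \<in> borel_measurable \<nu>"
    if "\<omega> \<in> atoms n" for c n x and \<omega> :: "(nat \<Rightarrow> 'x) set"
    by (intro borel_measurable_times_ennreal borel_measurable_const borel_measurable_indicator kid that)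
  have one: "(\<integral>\<^sup>+\<gamma>. ennreal c * indicator A \<gamma> \<partial>\<nu>) = ennreal (c * measure \<nu> A)"
    if "c \<ge> 0" "A \<in> sets \<nu>" for c A
    using that by (simp add: nn_integral_cmult_indicator emeasure_eq_measure ennreal_mult)
  have "norm (frac_integral \<alpha> \<phi> F \<gamma>) \<le> (\<Sum>n<N. \<Sum>\<omega>\<in>atoms n. \<Sum>x\<in>UNIV. ?c n \<omega> x * indicator (kid n \<omega> x) \<gamma>)" for \<gamma>
  proof -
    have "frac_integral \<alpha> \<phi> F \<gamma> = (\<Sum>n<N. \<Sum>\<omega>\<in>atoms n. \<Sum>x\<in>UNIV. of_real (real CARD('x) powr (- \<alpha> * real n)) *
        (\<phi> (mart_diff F n \<omega>) x * indicator (kid n \<omega> x) \<gamma>))"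
      using frac_integral_eq_sum[of N F \<phi> \<alpha> \<gamma>, OF F \<phi>] by (simp only: sum_distrib_left)
    then show ?thesis
      by (simp only:) (intro sum_norm_le, simp add: norm_mult indicator_def)
  qed
  then have "ennreal (norm (frac_integral \<alpha> \<phi> F \<gamma>))
      \<le> ennreal (\<Sum>n<N. \<Sum>\<omega>\<in>atoms n. \<Sum>x\<in>UNIV. ?c n \<omega> x * indicator (kid n \<omega> x) \<gamma>)" for \<gamma>
    by (rule ennreal_leI)
  moreover have "ennreal (\<Sum>n<N. \<Sum>\<omega>\<in>atoms n. \<Sum>x\<in>UNIV. ?c n \<omega> x * indicator (kid n \<omega> x) \<gamma>)
      = (\<Sum>n<N. \<Sum>\<omega>\<in>atoms n. \<Sum>x\<in>UNIV. ennreal (?c n \<omega> x) * indicator (kid n \<omega> x) \<gamma>)" for \<gamma>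
    by (subst ennreal_sum3) (auto intro!: sum.cong simp: indicator_def)
  ultimately have "(\<integral>\<^sup>+\<gamma>. ennreal (norm (frac_integral \<alpha> \<phi> F \<gamma>)) \<partial>\<nu>)
     \<le> (\<integral>\<^sup>+\<gamma>. (\<Sum>n<N. \<Sum>\<omega>\<in>atoms n. \<Sum>x\<in>UNIV. ennreal (?c n \<omega> x) * indicator (kid n \<omega> x) \<gamma>) \<partial>\<nu>)"
    by (intro nn_integral_mono) simp
  also have "\<dots> = (\<Sum>n<N. \<integral>\<^sup>+\<gamma>. (\<Sum>\<omega>\<in>atoms n. \<Sum>x\<in>UNIV. ennreal (?c n \<omega> x) * indicator (kid n \<omega> x) \<gamma>) \<partial>\<nu>)"
    by (rule nn_integral_sum, rule borel_measurable_sum, rule borel_measurable_sum, erule meas)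
  also have "\<dots> = (\<Sum>n<N. \<Sum>\<omega>\<in>atoms n. \<integral>\<^sup>+\<gamma>. (\<Sum>x\<in>UNIV. ennreal (?c n \<omega> x) * indicator (kid n \<omega> x) \<gamma>) \<partial>\<nu>)"
    by (rule sum.cong[OF refl], rule nn_integral_sum, rule borel_measurable_sum, erule meas)
  also have "\<dots> = (\<Sum>n<N. \<Sum>\<omega>\<in>atoms n. \<Sum>x\<in>UNIV. \<integral>\<^sup>+\<gamma>. ennreal (?c n \<omega> x) * indicator (kid n \<omega> x) \<gamma> \<partial>\<nu>)"
    by (rule sum.cong[OF refl], rule sum.cong[OF refl], rule nn_integral_sum, erule meas)
  also have "\<dots> = (\<Sum>n<N. \<Sum>\<omega>\<in>atoms n. \<Sum>x\<in>UNIV. ennreal (?c n \<omega> x * measure \<nu> (kid n \<omega> x)))"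
    by (rule sum.cong[OF refl], rule sum.cong[OF refl], rule sum.cong[OF refl], rule one) (simp, erule kid)
  also have "\<dots> = ennreal (\<Sum>n<N. \<Sum>\<omega>\<in>atoms n. \<Sum>x\<in>UNIV. ?c n \<omega> x * measure \<nu> (kid n \<omega> x))"
    by (rule ennreal_sum3[symmetric]) simp
  finally show ?thesis .
qed

section \<open>The cancellation condition implies the inequality\<close>

lemma powr_card_vec:
  fixes n :: nat
  defines "m \<equiv> real CARD('mu::nontriv mod_ring ^ 'd::finite)" and "\<mu> \<equiv> real CARD('mu)"
  shows "m powr (- (1 / real CARD('d)) * real n) = 1 / \<mu> ^ n"
    and "m powr ((1 - 1 / real CARD('d)) * real n) = (m / \<mu>) ^ n"
proof -
  have \<mu>: "\<mu> > 0" by (simp add: \<mu>_def)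
  have d: "real CARD('d) > 0" by simp
  have m: "m = \<mu> powr real CARD('d)"
    using \<mu> by (simp add: m_def \<mu>_def powr_realpow)
  have "m powr (- (1 / real CARD('d)) * real n) = \<mu> powr - real n"
    using d unfolding m powr_powr by simp
  then show "m powr (- (1 / real CARD('d)) * real n) = 1 / \<mu> ^ n"
    using \<mu> by (simp add: powr_minus powr_realpow divide_simps)
  have "m powr ((1 - 1 / real CARD('d)) * real n) = \<mu> powr (real CARD('d) * real n - real n)"
    using d unfolding m powr_powr by (simp add: algebra_simps)
  also have "\<dots> = (\<mu> powr real CARD('d) / \<mu>) ^ n"
    using \<mu> by (simp add: powr_diff powr_realpow power_divide flip: powr_powr)
  finally show "m powr ((1 - 1 / real CARD('d)) * real n) = (m / \<mu>) ^ n" unfolding m .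
qed

lemma nn_integral_norm_tree_prob:
  fixes f :: "(nat \<Rightarrow> 'x::finite) \<Rightarrow> 'b::real_normed_vector"
  assumes f: "depends_on_digits n f"
  shows "(\<integral>\<^sup>+\<gamma>. ennreal (norm (f \<gamma>)) \<partial>tree_prob)
      = ennreal (\<Sum>\<omega>\<in>atoms n. norm (value_on f \<omega>) / real CARD('x) ^ n)"
proof -
  have f': "depends_on_digits n (\<lambda>\<gamma>. ennreal (norm (f \<gamma>)))"
    using f unfolding depends_on_digits_def by metis
  have "(\<integral>\<^sup>+\<gamma>. ennreal (norm (f \<gamma>)) \<partial>tree_prob)
      = (\<Sum>\<omega>\<in>atoms n. value_on (\<lambda>\<gamma>. ennreal (norm (f \<gamma>))) \<omega> * emeasure tree_prob \<omega>)"
    by (rule nn_integral_depends_on_digits[OF sets_tree_prob f'])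
  also have "\<dots> = (\<Sum>\<omega>\<in>atoms n. ennreal (norm (value_on f \<omega>) / real CARD('x) ^ n))"
  proof (rule sum.cong[OF refl])
    fix \<omega> :: "(nat \<Rightarrow> 'x) set" assume \<omega>: "\<omega> \<in> atoms n"
    obtain \<gamma> where \<gamma>: "\<gamma> \<in> \<omega>" using atom_nonempty[OF \<omega>] by blast
    show "value_on (\<lambda>\<gamma>. ennreal (norm (f \<gamma>))) \<omega> * emeasure tree_prob \<omega>
        = ennreal (norm (value_on f \<omega>) / real CARD('x) ^ n)"
      unfolding depends_on_digits_value_on[OF f \<omega> \<gamma>] depends_on_digits_value_on[OF f' \<omega> \<gamma>]
        emeasure_tree_prob_atom[OF \<omega>]
      by (simp flip: ennreal_mult)
  qed
  also have "\<dots> = ennreal (\<Sum>\<omega>\<in>atoms n. norm (value_on f \<omega>) / real CARD('x) ^ n)"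
    by (rule sum_ennreal) simp
  finally show ?thesis .
qed

text \<open>The Bellman function argument. With \<open>v n \<omega>\<close> the value of \<open>F\<^sub>n\<close> on \<open>\<omega>\<close> and \<open>\<rho> n \<omega> = (m / \<mu>)\<^sup>n \<nu>(\<omega>) / G \<le> 1\<close>
  the normalized density of \<open>\<nu>\<close>, the sum of \<open>\<rho>\<close> over the kids of \<open>\<omega>\<close> is \<open>(m / \<mu>) (\<rho> n \<omega>)\<close>. So
  the local inequality with \<open>r x = \<rho> (n + 1) \<omega>\<^sub>x\<close> bounds the cost of step \<open>n\<close> by the decrease of the
  potential \<open>P n = \<Sum>\<^sub>\<omega> m\<^sup>-\<^sup>n |v n \<omega>| \<surd>(\<rho> n \<omega>)\<close> plus a multiple of the growth of \<open>E n = \<Sum>\<^sub>\<omega> m\<^sup>-\<^sup>n |v n \<omega>|\<close>,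
  which is the \<open>L\<^sub>1\<close> norm of \<open>F\<^sub>n\<close>. Both sums telescope, and \<open>0 \<le> P n \<le> E n \<le> L\<close>.\<close>

lemma telescoping_bound:
  fixes K :: "'mu::nontriv mod_ring ^ 'd::finite \<Rightarrow> complex ^ 'd"
    and F :: "nat \<Rightarrow> (nat \<Rightarrow> 'mu mod_ring ^ 'd) \<Rightarrow> complex ^ 'd"
  defines "m \<equiv> real CARD('mu mod_ring ^ 'd)" and "\<mu> \<equiv> real CARD('mu)"
  assumes t: "t > 0"
    and loc: "\<And>b r \<rho>. affine_gradient b \<Longrightarrow> (\<And>x. 0 \<le> r x) \<Longrightarrow> (\<Sum>x\<in>UNIV. r x) = m / \<mu> * \<rho> \<Longrightarrow> \<rho> \<le> 1 \<Longrightarrow>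
       (\<Sum>x\<in>UNIV. r x * norm (conv_op K b x))
       \<le> t * (\<Sum>x\<in>UNIV. norm (b x) * (sqrt \<rho> - sqrt (r x))) + t\<^sup>2 * ((\<Sum>x\<in>UNIV. norm (b x)) - norm (\<Sum>x\<in>UNIV. b x))"
    and K0: "(\<Sum>x\<in>UNIV. K x) = 0"
    and F: "\<And>n. depends_on_digits n (F n)"
    and W: "\<And>n \<omega>. \<omega> \<in> atoms n \<Longrightarrow> mart_diff F n \<omega> \<in> W_nabla"
    and \<nu>: "sets \<nu> = sets tree_borel" "finite_measure \<nu>"
    and G: "G > 0" "\<And>n \<omega>. \<omega> \<in> atoms n \<Longrightarrow> (m / \<mu>) ^ n * measure \<nu> \<omega> \<le> G"
    and L: "\<And>n. (\<Sum>\<omega>\<in>atoms n. norm (value_on (F n) \<omega>) / m ^ n) \<le> L"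
  shows "(\<Sum>n<N. \<Sum>\<omega>\<in>atoms n. \<Sum>x\<in>UNIV.
            1 / \<mu> ^ n * norm (conv_op K (mart_diff F n \<omega>) x) * measure \<nu> (kid n \<omega> x))
     \<le> \<mu> * (2 * t + t\<^sup>2) * G * L"
proof -
  have m: "m > 0" and \<mu>: "\<mu> > 0" by (simp_all add: m_def \<mu>_def)
  define q where "q = m / \<mu>"
  have q: "q > 0" using m \<mu> by (simp add: q_def)
  define v where "v n \<omega> = value_on (F n) \<omega>" for n \<omega>
  define \<rho> where "\<rho> n \<omega> = q ^ n * measure \<nu> \<omega> / G" for n \<omega>
  have \<rho>0: "\<rho> n \<omega> \<ge> 0" for n \<omega> using q G by (simp add: \<rho>_def)
  have \<rho>1: "\<rho> n \<omega> \<le> 1" if "\<omega> \<in> atoms n" for n \<omega>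
    using G(2)[OF that] G(1) by (simp add: \<rho>_def q_def)
  define P where "P n = (\<Sum>\<omega>\<in>atoms n. norm (v n \<omega>) * sqrt (\<rho> n \<omega>) / m ^ n)" for n
  define E where "E n = (\<Sum>\<omega>\<in>atoms n. norm (v n \<omega>) / m ^ n)" for n
  define cost where "cost n = (\<Sum>\<omega>\<in>atoms n. \<Sum>x\<in>UNIV.
            1 / \<mu> ^ n * norm (conv_op K (mart_diff F n \<omega>) x) * measure \<nu> (kid n \<omega> x))" for n
  have step: "(\<Sum>x\<in>UNIV. \<rho> (Suc n) (kid n \<omega> x) * norm (conv_op K (mart_diff F n \<omega>) x))
      \<le> t * (m * norm (v n \<omega>) * sqrt (\<rho> n \<omega>) - (\<Sum>x\<in>UNIV. norm (v (Suc n) (kid n \<omega> x)) * sqrt (\<rho> (Suc n) (kid n \<omega> x))))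
        + (t + t\<^sup>2) * ((\<Sum>x\<in>UNIV. norm (v (Suc n) (kid n \<omega> x))) - m * norm (v n \<omega>))"
    if \<omega>: "\<omega> \<in> atoms n" for n \<omega>
  proof -
    define b where "b x = v n \<omega> + mart_diff F n \<omega> x" for x
    have b: "b x = v (Suc n) (kid n \<omega> x)" for x
      by (simp add: b_def v_def mart_diff_eq[OF F F \<omega>])
    have "(\<Sum>x\<in>UNIV. mart_diff F n \<omega> x) = 0" using W[OF \<omega>] by (simp add: W_nabla_def V_tensor_def)
    then have "(\<Sum>x\<in>UNIV. b x) = m *\<^sub>R v n \<omega>"
      by (simp only: b_def sum.distrib sum_constant_scaleR m_def add_0_right)
    then have sb: "norm (\<Sum>x\<in>UNIV. b x) = m * norm (v n \<omega>)" using m by simp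
    have conv: "conv_op K b x = conv_op K (mart_diff F n \<omega>) x" for x
      unfolding b_def[abs_def] by (rule conv_op_add_const[OF K0])
    have "(\<Sum>x\<in>UNIV. \<rho> (Suc n) (kid n \<omega> x)) = q ^ Suc n * (\<Sum>x\<in>UNIV. measure \<nu> (kid n \<omega> x)) / G"
      by (simp only: \<rho>_def sum_divide_distrib sum_distrib_left)
    also have "\<dots> = q * \<rho> n \<omega>" unfolding measure_kids[OF \<nu> \<omega>] by (simp add: \<rho>_def)
    finally have "(\<Sum>x\<in>UNIV. \<rho> (Suc n) (kid n \<omega> x)) = m / \<mu> * \<rho> n \<omega>" by (simp add: q_def)
    moreover have "affine_gradient b"
      unfolding b_def[abs_def] by (rule affine_gradient_W_nabla[OF W[OF \<omega>]])
    ultimately have "(\<Sum>x\<in>UNIV. \<rho> (Suc n) (kid n \<omega> x) * norm (conv_op K b x))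
      \<le> t * (\<Sum>x\<in>UNIV. norm (b x) * (sqrt (\<rho> n \<omega>) - sqrt (\<rho> (Suc n) (kid n \<omega> x))))
        + t\<^sup>2 * ((\<Sum>x\<in>UNIV. norm (b x)) - norm (\<Sum>x\<in>UNIV. b x))"
      by (intro loc \<rho>0 \<rho>1 \<omega>)
    also have "(\<Sum>x\<in>UNIV. norm (b x) * (sqrt (\<rho> n \<omega>) - sqrt (\<rho> (Suc n) (kid n \<omega> x))))
       = m * norm (v n \<omega>) * sqrt (\<rho> n \<omega>) - (\<Sum>x\<in>UNIV. norm (b x) * sqrt (\<rho> (Suc n) (kid n \<omega> x)))
         + ((\<Sum>x\<in>UNIV. norm (b x)) - m * norm (v n \<omega>)) * sqrt (\<rho> n \<omega>)"
      by (simp add: right_diff_distrib left_diff_distrib sum_subtractf sum_distrib_right)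
    \<comment> \<open>The excess of \<open>\<Sum>\<^sub>x |b x|\<close> over \<open>m |v n \<omega>|\<close> is the gain in \<open>E\<close>, so its factor \<open>\<surd>\<rho>\<close> may be dropped.\<close>
    also have "t * \<dots> \<le> t * (m * norm (v n \<omega>) * sqrt (\<rho> n \<omega>) - (\<Sum>x\<in>UNIV. norm (b x) * sqrt (\<rho> (Suc n) (kid n \<omega> x)))
         + ((\<Sum>x\<in>UNIV. norm (b x)) - m * norm (v n \<omega>)) * 1)"
    proof (intro mult_left_mono add_left_mono)
      show "sqrt (\<rho> n \<omega>) \<le> 1" using \<rho>1[OF \<omega>] by simp
      show "0 \<le> (\<Sum>x\<in>UNIV. norm (b x)) - m * norm (v n \<omega>)"
        unfolding sb[symmetric] by (simp add: norm_sum)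
    qed (use t in auto)
    finally show ?thesis unfolding conv sb unfolding b by (simp add: algebra_simps)
  qed
  have cost: "cost n \<le> G * \<mu> * (t * (P n - P (Suc n)) + (t + t\<^sup>2) * (E (Suc n) - E n))" for n
  proof -
    have m1: "m * a / m ^ Suc n = a / m ^ n" for a using m by simp
    have "cost n = (\<Sum>\<omega>\<in>atoms n. G * \<mu> / m ^ Suc n *
        (\<Sum>x\<in>UNIV. \<rho> (Suc n) (kid n \<omega> x) * norm (conv_op K (mart_diff F n \<omega>) x)))"
      unfolding cost_def sum_distrib_left
      using m \<mu> G by (intro sum.cong refl) (simp add: \<rho>_def q_def field_simps)
    also have "\<dots> \<le> (\<Sum>\<omega>\<in>atoms n. G * \<mu> / m ^ Suc n *
        (t * (m * norm (v n \<omega>) * sqrt (\<rho> n \<omega>) - (\<Sum>x\<in>UNIV. norm (v (Suc n) (kid n \<omega> x)) * sqrt (\<rho> (Suc n) (kid n \<omega> x))))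
        + (t + t\<^sup>2) * ((\<Sum>x\<in>UNIV. norm (v (Suc n) (kid n \<omega> x))) - m * norm (v n \<omega>))))"
      using m \<mu> G by (intro sum_mono mult_left_mono step) auto
    also have "\<dots> = (\<Sum>\<omega>\<in>atoms n. G * \<mu> * (t * (norm (v n \<omega>) * sqrt (\<rho> n \<omega>) / m ^ n
          - (\<Sum>x\<in>UNIV. norm (v (Suc n) (kid n \<omega> x)) * sqrt (\<rho> (Suc n) (kid n \<omega> x)) / m ^ Suc n))
        + (t + t\<^sup>2) * ((\<Sum>x\<in>UNIV. norm (v (Suc n) (kid n \<omega> x)) / m ^ Suc n) - norm (v n \<omega>) / m ^ n)))"
      using m unfolding sum_divide_distrib[symmetric] by (intro sum.cong refl) (simp add: field_simps)
    also have "\<dots> = G * \<mu> * (t * (P n - P (Suc n)) + (t + t\<^sup>2) * (E (Suc n) - E n))"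
      unfolding P_def E_def sum_atoms_Suc by (simp add: sum.distrib sum_subtractf flip: sum_distrib_left)
    finally show ?thesis .
  qed
  have "(\<Sum>n<N. cost n) \<le> (\<Sum>n<N. G * \<mu> * (t * (P n - P (Suc n)) + (t + t\<^sup>2) * (E (Suc n) - E n)))"
    by (intro sum_mono cost)
  also have "\<dots> = G * \<mu> * (t * (P 0 - P N) + (t + t\<^sup>2) * (E N - E 0))"
  proof -
    have "(\<Sum>n<N. P n - P (Suc n)) = P 0 - P N" by (rule sum_lessThan_telescope')
    moreover have "(\<Sum>n<N. E (Suc n) - E n) = E N - E 0" by (rule sum_lessThan_telescope)
    ultimately show ?thesis by (simp add: sum.distrib flip: sum_distrib_left)
  qed
  also have "\<dots> \<le> G * \<mu> * (t * L + (t + t\<^sup>2) * L)"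
  proof -
    have "P 0 \<le> E 0"
      unfolding P_def E_def using \<rho>1 m
      by (intro sum_mono divide_right_mono mult_left_le) auto
    moreover have "P N \<ge> 0" "E 0 \<ge> 0" using m \<rho>0 by (auto simp: P_def E_def intro!: sum_nonneg)
    moreover have "E 0 \<le> L" "E N \<le> L" using L[of 0] L[of N] by (simp_all add: E_def v_def)
    ultimately have "t * (P 0 - P N) \<le> t * L" "(t + t\<^sup>2) * (E N - E 0) \<le> (t + t\<^sup>2) * L"
      using t by (auto intro!: mult_left_mono)
    then show ?thesis using G \<mu> by (intro mult_left_mono) auto
  qed
  finally show ?thesis unfolding cost_def by (simp add: algebra_simps power2_eq_square)
qed

lemma cancellation_imp_inequality:
  fixes K :: "'mu::nontriv mod_ring ^ 'd::finite \<Rightarrow> complex ^ 'd"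
  assumes K0: "(\<Sum>x\<in>UNIV. K x) = 0"
    and K: "\<And>D. (\<Sum>z | level D z = 0. pairing (K z) (\<Sum>j\<in>D. axis j 1)) = 0"
  shows "\<exists>C::real. \<forall>F \<nu>.
            F \<in> mart_space W_nabla \<and> simple_martingale F \<and>
            sets \<nu> = sets tree_borel \<and> finite_measure \<nu> \<and>
            growth_const (1 / real CARD('d)) \<nu> < \<infinity> \<longrightarrow>
            (\<integral>\<^sup>+\<gamma>. ennreal (norm (frac_integral (1 / real CARD('d)) (conv_op K) F \<gamma>)) \<partial>\<nu>)
              \<le> ennreal C * growth_const (1 / real CARD('d)) \<nu> * L1_norm F"
proof -
  define m where "m = real CARD('mu mod_ring ^ 'd)"
  define \<mu> where "\<mu> = real CARD('mu)"
  have m: "m > 0" and \<mu>: "\<mu> > 0" by (simp_all add: m_def \<mu>_def)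
  obtain t where t: "t > 0" and loc: "\<And>b r \<rho>. affine_gradient b \<Longrightarrow> (\<And>x. 0 \<le> r x) \<Longrightarrow>
       (\<Sum>x\<in>UNIV. r x) = m / \<mu> * \<rho> \<Longrightarrow> \<rho> \<le> 1 \<Longrightarrow>
       (\<Sum>x\<in>UNIV. r x * norm (conv_op K b x))
       \<le> t * (\<Sum>x\<in>UNIV. norm (b x) * (sqrt \<rho> - sqrt (r x))) + t\<^sup>2 * ((\<Sum>x\<in>UNIV. norm (b x)) - norm (\<Sum>x\<in>UNIV. b x))"
    using local_inequality[OF K] unfolding m_def \<mu>_def by blast
  define C where "C = \<mu> * (2 * t + t\<^sup>2)"
  have C: "C > 0" using \<mu> t by (simp add: C_def add_pos_pos)
  have "(\<integral>\<^sup>+\<gamma>. ennreal (norm (frac_integral (1 / real CARD('d)) (conv_op K) F \<gamma>)) \<partial>\<nu>)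
              \<le> ennreal C * growth_const (1 / real CARD('d)) \<nu> * L1_norm F"
    if F: "F \<in> mart_space W_nabla" and simple: "simple_martingale F"
      and \<nu>: "sets \<nu> = sets tree_borel" "finite_measure \<nu>"
      and fin: "growth_const (1 / real CARD('d)) \<nu> < \<infinity>" for F \<nu>
  proof -
    interpret finite_measure \<nu> by fact
    obtain N where N: "\<And>n. n \<ge> N \<Longrightarrow> F n = F N" using simple by (auto simp: simple_martingale_def)
    have dep: "depends_on_digits n (F n)" for n
      using F by (auto simp: mart_space_def tree_martingale_def intro: measurable_depends_on_digits)
    have W: "mart_diff F n \<omega> \<in> W_nabla" if "\<omega> \<in> atoms n" for n \<omega>
      using F that by (auto simp: mart_space_def)
    define E where "E n = (\<Sum>\<omega>\<in>atoms n. norm (value_on (F n) \<omega>) / m ^ n)" for n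
    have "L1_norm F = (SUP n. ennreal (E n))"
      unfolding L1_norm_def E_def m_def nn_integral_norm_tree_prob[OF dep] ..
    moreover have "L1_norm F < \<infinity>" using F by (simp add: mart_space_def)
    ultimately obtain L where L: "L1_norm F = ennreal L" "L \<ge> 0" and EL: "\<And>n. ennreal (E n) \<le> ennreal L"
      by (metis SUP_upper UNIV_I ennreal_cases infinity_ennreal_def less_irrefl)
    have EL: "E n \<le> L" for n using EL[of n] L by simp
    obtain G0 where G0: "growth_const (1 / real CARD('d)) \<nu> = ennreal G0" "G0 \<ge> 0"
      using fin by (metis ennreal_cases infinity_ennreal_def less_irrefl)
    have growth: "(m / \<mu>) ^ n * measure \<nu> \<omega> \<le> G0" if \<omega>: "\<omega> \<in> atoms n" for n \<omega>
    proof -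
      have "ennreal ((m / \<mu>) ^ n) * emeasure \<nu> \<omega> \<le> growth_const (1 / real CARD('d)) \<nu>"
        unfolding growth_const_def powr_card_vec(2) m_def \<mu>_def
        by (rule SUP_upper2[of n], simp, rule SUP_upper2[OF \<omega>], simp)
      then show ?thesis
        using m \<mu> G0 by (simp add: G0 emeasure_eq_measure flip: ennreal_mult)
    qed
    define S where "S = (\<Sum>n<N. \<Sum>\<omega>\<in>atoms n. \<Sum>x\<in>UNIV.
            1 / \<mu> ^ n * norm (conv_op K (mart_diff F n \<omega>) x) * measure \<nu> (kid n \<omega> x))"
    have S: "S \<le> C * G0 * L"
    \<comment> \<open>If \<open>G0 = 0\<close>, the density of \<open>\<nu>\<close> cannot be normalized, but \<open>\<nu>\<close> vanishes on all atoms.\<close>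
    proof (cases "G0 = 0")
      case True
      have "measure \<nu> (kid n \<omega> x) = 0" if "\<omega> \<in> atoms n" for n \<omega> x
      proof -
        have "(m / \<mu>) ^ Suc n > 0" using m \<mu> by simp
        moreover have "(m / \<mu>) ^ Suc n * measure \<nu> (kid n \<omega> x) \<le> 0"
          using growth[OF kid_in_atoms[OF that], of x] True by simp
        ultimately show ?thesis by (simp add: mult_le_0_iff measure_le_0_iff del: power_Suc)
      qed
      then have "S = 0" unfolding S_def by simp
      then show ?thesis using True by simp
    next
      case False
      show ?thesis
        unfolding S_def C_def m_def \<mu>_def
        by (rule telescoping_bound[OF t loc[unfolded m_def \<mu>_def] K0 dep W \<nu>])
           (use False G0 growth EL in \<open>auto simp: m_def \<mu>_def E_def\<close>)
    qed
    have "(\<integral>\<^sup>+\<gamma>. ennreal (norm (frac_integral (1 / real CARD('d)) (conv_op K) F \<gamma>)) \<partial>\<nu>) \<le> ennreal S"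
      using nn_integral_frac_integral_le[of N F "conv_op K" \<nu> "1 / real CARD('d)", OF N conv_op_zero \<nu>]
      unfolding powr_card_vec(1) S_def \<mu>_def .
    also have "\<dots> \<le> ennreal (C * G0 * L)" using S by (rule ennreal_leI)
    also have "\<dots> = ennreal C * growth_const (1 / real CARD('d)) \<nu> * L1_norm F"
      using C G0 L by (simp add: ennreal_mult)
    finally show ?thesis .
  qed
  then show ?thesis by (intro exI[of _ C]) blast
qed

section \<open>Martingales from their values on atoms\<close>

lemma prob_space_tree_prob: "prob_space (tree_prob :: (nat \<Rightarrow> 'x::finite) measure)"
  unfolding tree_prob_def by (rule prob_space_PiM, rule prob_space_uniform_count_measure) auto

lemma space_tree_prob [simp]: "space tree_prob = UNIV"
  by (simp add: tree_prob_def space_PiM space_uniform_count_measure)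

lemma depends_on_digits_vimage:
  fixes f :: "(nat \<Rightarrow> 'x::finite) \<Rightarrow> 'b"
  assumes f: "depends_on_digits n f"
  shows "f -` A \<in> sets (tree_filtration n)"
proof -
  have "f -` A = \<Union> {\<omega> \<in> atoms n. \<omega> \<subseteq> f -` A}"
  proof (intro equalityI subsetI)
    fix \<gamma> assume \<gamma>: "\<gamma> \<in> f -` A"
    have "cylinder n \<gamma> \<subseteq> f -` A"
    proof
      fix \<gamma>' assume "\<gamma>' \<in> cylinder n \<gamma>"
      then have "f \<gamma>' = f \<gamma>" using f by (auto simp: depends_on_digits_def cylinder_def)
      then show "\<gamma>' \<in> f -` A" using \<gamma> by simp
    qed
    then show "\<gamma> \<in> \<Union> {\<omega> \<in> atoms n. \<omega> \<subseteq> f -` A}"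
      by (intro UnionI[of "cylinder n \<gamma>"]) auto
  qed auto
  also have "\<dots> \<in> sets (tree_filtration n)"
    by (rule sets.finite_Union) (auto simp: sets_tree_filtration)
  finally show ?thesis .
qed

lemma depends_on_digits_measurable:
  fixes f :: "(nat \<Rightarrow> 'x::finite) \<Rightarrow> 'b::topological_space"
  shows "depends_on_digits n f \<Longrightarrow> f \<in> borel_measurable (tree_filtration n)"
  by (rule measurableI) (auto intro: depends_on_digits_vimage)

lemma sets_tree_filtration_subset:
  "sets (tree_filtration n) \<subseteq> sets (tree_borel :: (nat \<Rightarrow> 'x::finite) measure)"
  unfolding sets_tree_filtration
  by (metis atom_in_tree_borel sets.sigma_sets_subset sets_tree_prob space_tree_prob subsetI)

lemma depends_on_digits_measurable_tree_prob:
  fixes f :: "(nat \<Rightarrow> 'x::finite) \<Rightarrow> 'b::topological_space"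
  assumes "depends_on_digits n f"
  shows "f \<in> borel_measurable tree_prob"
  using depends_on_digits_vimage[OF assms] sets_tree_filtration_subset[of n]
  by (intro measurableI) (auto simp: sets_tree_prob)

lemma integral_depends_on_digits:
  fixes f :: "(nat \<Rightarrow> 'x::finite) \<Rightarrow> 'b::{banach, second_countable_topology}"
  assumes f: "depends_on_digits n f"
  shows "integrable tree_prob f"
    and "(\<integral>\<gamma>. f \<gamma> \<partial>tree_prob) = (\<Sum>\<omega>\<in>atoms n. (1 / real CARD('x) ^ n) *\<^sub>R value_on f \<omega>)"
proof -
  interpret prob_space "tree_prob :: (nat \<Rightarrow> 'x) measure" by (rule prob_space_tree_prob)
  have eq: "f = (\<lambda>\<gamma>. \<Sum>\<omega>\<in>atoms n. indicator \<omega> \<gamma> *\<^sub>R value_on f \<omega>)"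
  proof
    fix \<gamma>
    have "(\<Sum>\<omega>\<in>atoms n. indicator \<omega> \<gamma> *\<^sub>R value_on f \<omega>) = (\<Sum>\<omega>\<in>atoms n. if \<omega> = cylinder n \<gamma> then value_on f \<omega> else 0)"
      by (rule sum.cong) (auto simp: indicator_def dest: atom_eq_cylinder)
    then show "f \<gamma> = (\<Sum>\<omega>\<in>atoms n. indicator \<omega> \<gamma> *\<^sub>R value_on f \<omega>)"
      by (simp add: depends_on_digits_value_on[OF f cylinder_in_atoms in_cylinder_self])
  qed
  have meas: "\<omega> \<in> sets (tree_prob :: (nat \<Rightarrow> 'x) measure)" if "\<omega> \<in> atoms n" for \<omega>
    using that by (simp add: sets_tree_prob)
  have int: "has_bochner_integral tree_prob (\<lambda>\<gamma>. indicator \<omega> \<gamma> *\<^sub>R value_on f \<omega>) ((1 / real CARD('x) ^ n) *\<^sub>R value_on f \<omega>)"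
    if \<omega>: "\<omega> \<in> atoms n" for \<omega>
  proof -
    have "measure tree_prob \<omega> = 1 / real CARD('x) ^ n"
      using emeasure_tree_prob_atom[OF \<omega>] by (simp add: measure_def)
    then show ?thesis
      using has_bochner_integral_indicator[OF meas[OF \<omega>], of "value_on f \<omega>"] by (simp add: emeasure_eq_measure)
  qed
  have "has_bochner_integral tree_prob (\<lambda>\<gamma>. \<Sum>\<omega>\<in>atoms n. indicator \<omega> \<gamma> *\<^sub>R value_on f \<omega>)
     (\<Sum>\<omega>\<in>atoms n. (1 / real CARD('x) ^ n) *\<^sub>R value_on f \<omega>)"
    by (intro has_bochner_integral_sum int)
  then have "has_bochner_integral tree_prob f (\<Sum>\<omega>\<in>atoms n. (1 / real CARD('x) ^ n) *\<^sub>R value_on f \<omega>)"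
    unfolding eq[symmetric] .
  then show "integrable tree_prob f"
    and "(\<integral>\<gamma>. f \<gamma> \<partial>tree_prob) = (\<Sum>\<omega>\<in>atoms n. (1 / real CARD('x) ^ n) *\<^sub>R value_on f \<omega>)"
    by (simp_all add: has_bochner_integral_iff)
qed

lemma tree_martingaleI:
  fixes F :: "nat \<Rightarrow> (nat \<Rightarrow> 'x::finite) \<Rightarrow> complex ^ 'd::finite"
  assumes F: "\<And>n. depends_on_digits n (F n)"
    and zero: "\<And>n \<omega>. \<omega> \<in> atoms n \<Longrightarrow> (\<Sum>x\<in>UNIV. mart_diff F n \<omega> x) = 0"
  shows "tree_martingale F"
  unfolding tree_martingale_def
proof (intro conjI allI ballI)
  fix n :: nat
  show "F n \<in> borel_measurable (tree_filtration n)" "integrable tree_prob (F n)"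
    by (rule depends_on_digits_measurable[OF F], rule integral_depends_on_digits(1)[OF F])
  fix A :: "(nat \<Rightarrow> 'x) set" assume A: "A \<in> sets (tree_filtration n)"
  define m where "m = real CARD('x)"
  have m: "m > 0" by (simp add: m_def)
  have dep: "depends_on_digits k (\<lambda>\<gamma>. indicator A \<gamma> *\<^sub>R F k \<gamma>)" if "k \<ge> n" for k
    unfolding depends_on_digits_def
  proof (intro allI impI)
    fix \<gamma> \<gamma>' :: "nat \<Rightarrow> 'x" assume *: "\<forall>i<k. \<gamma> i = \<gamma>' i"
    then have "\<gamma> \<in> A \<longleftrightarrow> \<gamma>' \<in> A" using that by (intro tree_filtration_saturated[OF A]) auto
    moreover have "F k \<gamma> = F k \<gamma>'" using F[of k] * unfolding depends_on_digits_def by blast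
    ultimately show "indicator A \<gamma> *\<^sub>R F k \<gamma> = indicator A \<gamma>' *\<^sub>R F k \<gamma>'"
      by (simp add: indicator_def)
  qed
  have "(LINT \<gamma>:A|tree_prob. F (Suc n) \<gamma>)
      = (\<Sum>\<omega>\<in>atoms n. \<Sum>x\<in>UNIV. (1 / m ^ Suc n) *\<^sub>R value_on (\<lambda>\<gamma>. indicator A \<gamma> *\<^sub>R F (Suc n) \<gamma>) (kid n \<omega> x))"
    unfolding set_lebesgue_integral_def m_def
    by (subst integral_depends_on_digits(2)[of "Suc n"]) (simp_all only: dep sum_atoms_Suc le_SucI order_refl)
  also have "\<dots> = (\<Sum>\<omega>\<in>atoms n. (1 / m ^ n) *\<^sub>R value_on (\<lambda>\<gamma>. indicator A \<gamma> *\<^sub>R F n \<gamma>) \<omega>)"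
  proof (rule sum.cong[OF refl])
    fix \<omega> :: "(nat \<Rightarrow> 'x) set" assume \<omega>: "\<omega> \<in> atoms n"
    obtain \<gamma> where \<gamma>: "\<gamma> \<in> \<omega>" using atom_nonempty[OF \<omega>] by blast
    have v: "value_on (\<lambda>\<gamma>. indicator A \<gamma> *\<^sub>R F (Suc n) \<gamma>) (kid n \<omega> x)
        = indicator A \<gamma> *\<^sub>R (value_on (F n) \<omega> + mart_diff F n \<omega> x)" for x
    proof -
      obtain \<gamma>' where \<gamma>': "\<gamma>' \<in> kid n \<omega> x" using atom_nonempty[OF kid_in_atoms[OF \<omega>]] by blast
      have "\<forall>i<n. \<gamma>' i = \<gamma> i" using \<gamma> \<gamma>' \<omega> by (auto simp: kid_def atoms_def)
      then have "(\<gamma>' \<in> A) = (\<gamma> \<in> A)" by (rule tree_filtration_saturated[OF A])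
      then show ?thesis
        unfolding depends_on_digits_value_on[OF dep[OF le_SucI[OF order_refl]] kid_in_atoms[OF \<omega>] \<gamma>']
          mart_diff_eq[OF F F \<omega>] depends_on_digits_value_on[OF F kid_in_atoms[OF \<omega>] \<gamma>']
        by (simp add: indicator_def)
    qed
    have "(\<Sum>x\<in>UNIV. value_on (F n) \<omega> + mart_diff F n \<omega> x) = m *\<^sub>R value_on (F n) \<omega>"
      by (simp only: sum.distrib zero[OF \<omega>] sum_constant_scaleR m_def add_0_right)
    then show "(\<Sum>x\<in>UNIV. (1 / m ^ Suc n) *\<^sub>R value_on (\<lambda>\<gamma>. indicator A \<gamma> *\<^sub>R F (Suc n) \<gamma>) (kid n \<omega> x))
        = (1 / m ^ n) *\<^sub>R value_on (\<lambda>\<gamma>. indicator A \<gamma> *\<^sub>R F n \<gamma>) \<omega>"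
      unfolding v depends_on_digits_value_on[OF dep[OF order_refl] \<omega> \<gamma>] depends_on_digits_value_on[OF F \<omega> \<gamma>]
      using m by (simp flip: scaleR_sum_right)
  qed
  also have "\<dots> = (LINT \<gamma>:A|tree_prob. F n \<gamma>)"
    unfolding set_lebesgue_integral_def m_def
    by (subst integral_depends_on_digits(2)[of n]) (simp_all only: dep order_refl)
  finally show "(LINT \<gamma>:A|tree_prob. F (Suc n) \<gamma>) = (LINT \<gamma>:A|tree_prob. F n \<gamma>)" .
qed

section \<open>The inequality implies the cancellation condition\<close>

text \<open>Density of the probability measure that draws the first \<open>k\<close> digits uniformly from
  \<open>{x. level D x = 0}\<close> and the others uniformly from the whole group.\<close>

definition level_density :: "'d::finite set \<Rightarrow> nat \<Rightarrow> (nat \<Rightarrow> 'mu::nontriv mod_ring ^ 'd) \<Rightarrow> real" where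
  "level_density D k \<gamma> = (if \<forall>i<k. level D (\<gamma> i) = 0 then real CARD('mu) ^ k else 0)"

definition level_measure :: "'d::finite set \<Rightarrow> nat \<Rightarrow> (nat \<Rightarrow> 'mu::nontriv mod_ring ^ 'd) measure" where
  "level_measure D k = density tree_prob (\<lambda>\<gamma>. ennreal (level_density D k \<gamma>))"

definition level_martingale ::
  "'d::finite set \<Rightarrow> nat \<Rightarrow> nat \<Rightarrow> (nat \<Rightarrow> 'mu::nontriv mod_ring ^ 'd) \<Rightarrow> complex ^ 'd" where
  "level_martingale D N n \<gamma> = level_density D (min n N) \<gamma> *\<^sub>R (\<Sum>j\<in>D. axis j 1)"

lemma level_density_nonneg [simp]: "level_density D k \<gamma> \<ge> 0"
  by (simp add: level_density_def)

lemma depends_on_digits_level_density: "depends_on_digits k (level_density D k)"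
  by (simp add: depends_on_digits_def level_density_def)

lemma sets_level_measure: "sets (level_measure D k) = sets tree_borel"
  by (simp add: level_measure_def sets_tree_prob)

lemma level_measure_atom_ge:
  fixes D :: "'d::finite set" and \<gamma> :: "nat \<Rightarrow> 'mu::nontriv mod_ring ^ 'd"
  assumes kn: "k \<le> n" and \<omega>: "\<omega> \<in> atoms n" "\<gamma> \<in> \<omega>"
  shows "emeasure (level_measure D k) \<omega> = ennreal (level_density D k \<gamma> / real CARD('mu mod_ring ^ 'd) ^ n)"
proof -
  have "emeasure (level_measure D k) \<omega> = (\<integral>\<^sup>+\<gamma>'. ennreal (level_density D k \<gamma>') * indicator \<omega> \<gamma>' \<partial>tree_prob)"
    unfolding level_measure_def
    by (rule emeasure_density)
       (use \<omega> in \<open>auto simp: sets_tree_prob intro!: measurable_compose[OF _ measurable_ennreal]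
          depends_on_digits_measurable_tree_prob[OF depends_on_digits_level_density]\<close>)
  also have "\<dots> = (\<integral>\<^sup>+\<gamma>'. ennreal (level_density D k \<gamma>) * indicator \<omega> \<gamma>' \<partial>tree_prob)"
  proof (rule nn_integral_cong)
    fix \<gamma>'
    show "ennreal (level_density D k \<gamma>') * indicator \<omega> \<gamma>' = ennreal (level_density D k \<gamma>) * indicator \<omega> \<gamma>'"
    proof (cases "\<gamma>' \<in> \<omega>")
      case True
      then have "\<forall>i<n. \<gamma>' i = \<gamma> i" using \<omega> by (auto simp: atoms_def)
      then have "level_density D k \<gamma>' = level_density D k \<gamma>"
        using depends_on_digits_mono[OF depends_on_digits_level_density kn] unfolding depends_on_digits_def by blast
      then show ?thesis by simp
    qed simp
  qed
  also have "\<dots> = ennreal (level_density D k \<gamma>) * emeasure tree_prob \<omega>"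
    using \<omega> by (simp add: nn_integral_cmult_indicator sets_tree_prob)
  also have "\<dots> = ennreal (level_density D k \<gamma> / real CARD('mu mod_ring ^ 'd) ^ n)"
    unfolding emeasure_tree_prob_atom[OF \<omega>(1)] by (simp flip: ennreal_mult)
  finally show ?thesis .
qed

lemma level_density_kid:
  "\<gamma>' \<in> kid n (cylinder n \<gamma>) x \<Longrightarrow>
    level_density D (Suc n) \<gamma>' = (if level D x = 0 then real CARD('mu) else 0) * level_density D n \<gamma>"
  for \<gamma> \<gamma>' :: "nat \<Rightarrow> 'mu::nontriv mod_ring ^ 'd::finite"
  by (auto simp: level_density_def kid_def cylinder_def less_Suc_eq)

lemma sum_level_zero:
  fixes D :: "'d::finite set"
  assumes "D \<noteq> {}"
  shows "(\<Sum>x\<in>(UNIV :: ('mu::nontriv mod_ring ^ 'd) set). if level D x = 0 then real CARD('mu) else 0)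
      = real CARD('mu mod_ring ^ 'd)"
proof -
  have "(\<Sum>x\<in>(UNIV :: ('mu mod_ring ^ 'd) set). if level D x = 0 then real CARD('mu) else 0)
      = real (card {x :: 'mu mod_ring ^ 'd. level D x = 0}) * real CARD('mu)"
    by (simp add: sum.If_cases)
  also have "\<dots> = real CARD('mu mod_ring ^ 'd)"
    unfolding card_level_real[OF assms, of "0 :: 'mu mod_ring"] by simp
  finally show ?thesis .
qed

text \<open>Up to level \<open>k\<close> the measure of an atom is that of the density truncated at the level of the atom:
  the densities \<open>level_density D n\<close> form a martingale, as seen by summing over the kids, from level
  \<open>k\<close> downwards.\<close>

lemma level_measure_atom_le:
  fixes D :: "'d::finite set" and \<gamma> :: "nat \<Rightarrow> 'mu::nontriv mod_ring ^ 'd"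
  assumes D: "D \<noteq> {}" and "n \<le> k" and "\<omega> \<in> atoms n" "\<gamma> \<in> \<omega>"
  shows "emeasure (level_measure D k) \<omega> = ennreal (level_density D n \<gamma> / real CARD('mu mod_ring ^ 'd) ^ n)"
  using assms(2-)
proof (induction arbitrary: \<omega> \<gamma> rule: inc_induct)
  case base
  then show ?case by (intro level_measure_atom_ge) auto
next
  case (step n)
  let ?m = "real CARD('mu mod_ring ^ 'd)"
  have \<omega>: "\<omega> = cylinder n \<gamma>" using step.prems by (rule atom_eq_cylinder)
  have kids: "emeasure (level_measure D k) (kid n \<omega> x)
      = ennreal ((if level D x = 0 then real CARD('mu) else 0) * (level_density D n \<gamma> / ?m ^ Suc n))" for x
  proof -
    obtain \<gamma>' where \<gamma>': "\<gamma>' \<in> kid n \<omega> x" using atom_nonempty[OF kid_in_atoms[OF step.prems(1)]] by blast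
    show ?thesis
      unfolding step.IH[OF kid_in_atoms[OF step.prems(1)] \<gamma>'] level_density_kid[OF \<gamma>'[unfolded \<omega>]] by simp
  qed
  have "\<omega> = (\<Union>x. kid n \<omega> x)" by (auto simp: kid_def)
  also have "emeasure (level_measure D k) \<dots> = (\<Sum>x\<in>UNIV. emeasure (level_measure D k) (kid n \<omega> x))"
    by (rule sum_emeasure[symmetric])
       (auto simp: disjoint_family_on_def kid_def sets_level_measure
         intro!: atom_in_tree_borel[OF kid_in_atoms[OF step.prems(1)], unfolded kid_def])
  also have "\<dots> = ennreal (\<Sum>x\<in>(UNIV :: ('mu mod_ring ^ 'd) set). (if level D x = 0 then real CARD('mu) else 0) * (level_density D n \<gamma> / ?m ^ Suc n))"
    unfolding kids by (rule sum_ennreal) simp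
  also have "\<dots> = ennreal (level_density D n \<gamma> / ?m ^ n)"
    unfolding sum_distrib_right[symmetric] sum_level_zero[OF D] by simp
  finally show ?case .
qed

text \<open>The potential \<open>t \<mapsto> - to_int_mod_ring (t - 1)\<close> on the cyclic group has the difference \<open>\<mu> - 1\<close> at \<open>t = 0\<close> and
  \<open>- 1\<close> elsewhere; it exhibits the concentrated fields below as gradients.\<close>

lemma to_int_mod_ring_step:
  fixes t :: "'mu::nontriv mod_ring"
  shows "real_of_int (to_int_mod_ring (t - 1)) - real_of_int (to_int_mod_ring t)
     = (if t = 0 then real CARD('mu) else 0) - 1"
proof -
  let ?r = "Rep_mod_ring t"
  have \<mu>: "int CARD('mu) > 1" using nontriv[where 'a = 'mu] by simp
  have r: "0 \<le> ?r" "?r < int CARD('mu)" using Rep_mod_ring[of t] by auto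
  have t0: "t = 0 \<longleftrightarrow> ?r = 0" by (metis Rep_mod_ring_inject zero_mod_ring.rep_eq)
  have "Rep_mod_ring (t - 1) = (?r - 1) mod int CARD('mu)"
    by (simp add: minus_mod_ring.rep_eq one_mod_ring.rep_eq)
  also have "\<dots> = ?r - 1 + (if t = 0 then int CARD('mu) else 0)"
  proof (cases "t = 0")
    case True
    then show ?thesis using t0 \<mu> by (simp add: zmod_minus1)
  next
    case False
    then show ?thesis using t0 r by simp
  qed
  finally have "to_int_mod_ring (t - 1) - to_int_mod_ring t = (if t = 0 then int CARD('mu) else 0) - 1"
    by (simp add: to_int_mod_ring.rep_eq)
  then have "real_of_int (to_int_mod_ring (t - 1) - to_int_mod_ring t)
      = real_of_int ((if t = 0 then int CARD('mu) else 0) - 1)" by (rule arg_cong)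
  then show ?thesis by (simp split: if_splits)
qed

lemma level_gradient_in_W_nabla:
  fixes D :: "'d::finite set"
  assumes D: "D \<noteq> {}"
  shows "(\<lambda>x :: 'mu::nontriv mod_ring ^ 'd.
      (s * ((if level D x = 0 then real CARD('mu) else 0) - 1)) *\<^sub>R (\<Sum>j\<in>D. axis j 1)) \<in> W_nabla"
proof -
  define e where "e = (\<Sum>j\<in>D. axis j 1 :: complex ^ 'd)"
  have e: "e $ j = (if j \<in> D then 1 else 0)" for j
    unfolding e_def by (simp add: axis_def)
  have "(\<Sum>x\<in>(UNIV :: ('mu mod_ring ^ 'd) set). (if level D x = 0 then real CARD('mu) else 0) - 1) = 0"
    unfolding sum_subtractf sum_level_zero[OF D] by simp
  then have "(\<Sum>x\<in>(UNIV :: ('mu mod_ring ^ 'd) set). (s * ((if level D x = 0 then real CARD('mu) else 0) - 1)) *\<^sub>R e) = 0"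
    by (simp flip: scaleR_sum_left sum_distrib_left)
  moreover have "((s * ((if level D x = 0 then real CARD('mu) else 0) - 1)) *\<^sub>R e) $ j
      = complex_of_real (- s * to_int_mod_ring (level D (x + axis j 1) - 1)) - complex_of_real (- s * to_int_mod_ring (level D x - 1))"
    for x :: "'mu mod_ring ^ 'd" and j
    unfolding to_int_mod_ring_step[symmetric]
    by (simp only: vector_scaleR_component e level_add level_axis)
       (simp add: scaleR_conv_of_real algebra_simps)
  ultimately show ?thesis
    unfolding W_nabla_def V_tensor_def e_def[symmetric]
    by (intro CollectI conjI exI[of _ "\<lambda>x. complex_of_real (- s * to_int_mod_ring (level D x - 1))"] allI) simp_all
qed

lemma depends_on_digits_level_martingale: "depends_on_digits n (level_martingale D N n)"
proof -
  have "depends_on_digits n (level_density D (min n N))"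
    by (rule depends_on_digits_mono[OF depends_on_digits_level_density]) simp
  then show ?thesis unfolding depends_on_digits_def level_martingale_def by metis
qed

lemma mart_diff_level_martingale:
  fixes D :: "'d::finite set" and \<gamma> :: "nat \<Rightarrow> 'mu::nontriv mod_ring ^ 'd"
  assumes "n < N"
  shows "mart_diff (level_martingale D N) n (cylinder n \<gamma>) x
    = (level_density D n \<gamma> * ((if level D x = 0 then real CARD('mu) else 0) - 1)) *\<^sub>R (\<Sum>j\<in>D. axis j 1)"
proof -
  obtain \<gamma>' where \<gamma>': "\<gamma>' \<in> kid n (cylinder n \<gamma>) x"
    using atom_nonempty[OF kid_in_atoms[OF cylinder_in_atoms[of n \<gamma>]]] by blast
  have "mart_diff (level_martingale D N) n (cylinder n \<gamma>) x
      = level_martingale D N (Suc n) \<gamma>' - level_martingale D N n \<gamma>"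
    unfolding mart_diff_eq[OF depends_on_digits_level_martingale depends_on_digits_level_martingale cylinder_in_atoms]
      depends_on_digits_value_on[OF depends_on_digits_level_martingale kid_in_atoms[OF cylinder_in_atoms] \<gamma>']
      depends_on_digits_value_on[OF depends_on_digits_level_martingale cylinder_in_atoms in_cylinder_self] ..
  moreover have "min (Suc n) N = Suc n" "min n N = n" using assms by auto
  ultimately show ?thesis
    unfolding level_martingale_def by (simp only: level_density_kid[OF \<gamma>'] scaleR_diff_left[symmetric]) (simp add: algebra_simps)
qed

lemma mart_diff_level_martingale_in_W_nabla:
  fixes D :: "'d::finite set"
  assumes D: "D \<noteq> {}" and \<omega>: "\<omega> \<in> (atoms n :: (nat \<Rightarrow> 'mu::nontriv mod_ring ^ 'd) set set)"
  shows "mart_diff (level_martingale D N) n \<omega> \<in> W_nabla"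
proof (cases "n < N")
  case True
  obtain \<gamma> where \<gamma>: "\<omega> = cylinder n \<gamma>" using \<omega> by (auto simp: atoms_eq)
  have "mart_diff (level_martingale D N) n \<omega>
      = (\<lambda>x. (level_density D n \<gamma> * ((if level D x = 0 then real CARD('mu) else 0) - 1)) *\<^sub>R (\<Sum>j\<in>D. axis j 1))"
    unfolding \<gamma> by (intro ext mart_diff_level_martingale[OF True])
  then show ?thesis using level_gradient_in_W_nabla[OF D] by simp
next
  case False
  then have "min (Suc n) N = min n N" by auto
  then have "level_martingale D N (Suc n) = (level_martingale D N n :: (nat \<Rightarrow> 'mu mod_ring ^ 'd) \<Rightarrow> _)"
    by (simp add: level_martingale_def fun_eq_iff)
  from mart_diff_stationary[OF this \<omega>] show ?thesis
    using level_gradient_in_W_nabla[OF D, of 0] by simp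
qed

lemma prob_space_level_measure:
  fixes D :: "'d::finite set"
  assumes D: "D \<noteq> {}"
  shows "prob_space (level_measure D N :: (nat \<Rightarrow> 'mu::nontriv mod_ring ^ 'd) measure)"
proof
  have "emeasure (level_measure D N) (UNIV :: (nat \<Rightarrow> 'mu mod_ring ^ 'd) set)
      = ennreal (level_density D 0 (undefined :: nat \<Rightarrow> 'mu mod_ring ^ 'd) / real CARD('mu mod_ring ^ 'd) ^ 0)"
    by (rule level_measure_atom_le[OF D]) (auto simp: atoms_0)
  then show "emeasure (level_measure D N) (space (level_measure D N :: (nat \<Rightarrow> 'mu mod_ring ^ 'd) measure)) = 1"
    by (simp add: level_density_def level_measure_def)
qed

lemma nn_integral_level_density:
  fixes D :: "'d::finite set"
  assumes D: "D \<noteq> {}"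
  shows "(\<integral>\<^sup>+\<gamma>. ennreal (level_density D k (\<gamma> :: nat \<Rightarrow> 'mu::nontriv mod_ring ^ 'd)) \<partial>tree_prob) = 1"
proof -
  interpret P: prob_space "level_measure D k :: (nat \<Rightarrow> 'mu mod_ring ^ 'd) measure"
    by (rule prob_space_level_measure[OF D])
  have "(\<integral>\<^sup>+\<gamma>. ennreal (level_density D k (\<gamma> :: nat \<Rightarrow> 'mu mod_ring ^ 'd)) \<partial>tree_prob)
     = emeasure (level_measure D k) (space (level_measure D k :: (nat \<Rightarrow> 'mu mod_ring ^ 'd) measure))"
    unfolding level_measure_def
    by (subst emeasure_density)
       (auto intro!: sets.top[of tree_prob, simplified] measurable_compose[OF _ measurable_ennreal]
          depends_on_digits_measurable_tree_prob[OF depends_on_digits_level_density])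
  also have "\<dots> = 1" by (rule P.emeasure_space_1)
  finally show ?thesis .
qed

lemma L1_norm_level_martingale:
  fixes D :: "'d::finite set"
  assumes D: "D \<noteq> {}"
  shows "L1_norm (level_martingale D N :: nat \<Rightarrow> (nat \<Rightarrow> 'mu::nontriv mod_ring ^ 'd) \<Rightarrow> complex ^ 'd)
    = ennreal (norm (\<Sum>j\<in>D. axis j 1 :: complex ^ 'd))"
proof -
  define e where "e = (\<Sum>j\<in>D. axis j 1 :: complex ^ 'd)"
  have "(\<integral>\<^sup>+\<gamma>. ennreal (norm (level_martingale D N n (\<gamma> :: nat \<Rightarrow> 'mu mod_ring ^ 'd))) \<partial>tree_prob) = ennreal (norm e)" for n
  proof -
    have "(\<integral>\<^sup>+\<gamma>. ennreal (norm (level_martingale D N n (\<gamma> :: nat \<Rightarrow> 'mu mod_ring ^ 'd))) \<partial>tree_prob)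
      = (\<integral>\<^sup>+\<gamma>. ennreal (norm e) * ennreal (level_density D (min n N) (\<gamma> :: nat \<Rightarrow> 'mu mod_ring ^ 'd)) \<partial>tree_prob)"
      by (simp add: level_martingale_def e_def mult.commute flip: ennreal_mult)
    also have "\<dots> = ennreal (norm e) * (\<integral>\<^sup>+\<gamma>. ennreal (level_density D (min n N) (\<gamma> :: nat \<Rightarrow> 'mu mod_ring ^ 'd)) \<partial>tree_prob)"
      by (rule nn_integral_cmult)
         (auto intro!: measurable_compose[OF _ measurable_ennreal]
          depends_on_digits_measurable_tree_prob[OF depends_on_digits_level_density])
    finally show ?thesis by (simp add: nn_integral_level_density[OF D])
  qed
  then show ?thesis unfolding L1_norm_def e_def by simp
qed

lemma level_martingale_in_mart_space:
  fixes D :: "'d::finite set"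
  assumes D: "D \<noteq> {}"
  shows "(level_martingale D N :: nat \<Rightarrow> (nat \<Rightarrow> 'mu::nontriv mod_ring ^ 'd) \<Rightarrow> complex ^ 'd) \<in> mart_space W_nabla"
proof -
  have W: "mart_diff (level_martingale D N) n \<omega> \<in> W_nabla" if "\<omega> \<in> atoms n"
    for n and \<omega> :: "(nat \<Rightarrow> 'mu mod_ring ^ 'd) set"
    by (rule mart_diff_level_martingale_in_W_nabla[OF D that])
  then have "(\<Sum>x\<in>UNIV. mart_diff (level_martingale D N) n \<omega> x) = 0" if "\<omega> \<in> atoms n"
    for n and \<omega> :: "(nat \<Rightarrow> 'mu mod_ring ^ 'd) set"
    using that by (auto simp: W_nabla_def V_tensor_def)
  then have "tree_martingale (level_martingale D N :: nat \<Rightarrow> (nat \<Rightarrow> 'mu mod_ring ^ 'd) \<Rightarrow> complex ^ 'd)"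
    by (intro tree_martingaleI depends_on_digits_level_martingale)
  with W show ?thesis
    unfolding mart_space_def by (simp add: L1_norm_level_martingale[OF D])
qed

text \<open>An atom of level \<open>n\<close> has measure at most \<open>\<mu>\<^sup>n / m\<^sup>n\<close>, also beyond level \<open>N\<close>, where the density no longer
  grows.\<close>

lemma growth_const_level_measure_le:
  fixes D :: "'d::finite set"
  assumes D: "D \<noteq> {}"
  shows "growth_const (1 / real CARD('d)) (level_measure D N :: (nat \<Rightarrow> 'mu::nontriv mod_ring ^ 'd) measure) \<le> 1"
  unfolding growth_const_def powr_card_vec(2)
proof (intro SUP_least)
  fix n and \<omega> :: "(nat \<Rightarrow> 'mu mod_ring ^ 'd) set" assume \<omega>: "\<omega> \<in> atoms n"
  define m where "m = real CARD('mu mod_ring ^ 'd)"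
  define \<mu> where "\<mu> = real CARD('mu)"
  have m: "m > 0" by (simp add: m_def)
  have \<mu>: "\<mu> \<ge> 1" using nontriv[where 'a = 'mu] by (simp add: \<mu>_def)
  obtain \<gamma> where \<gamma>: "\<gamma> \<in> \<omega>" using atom_nonempty[OF \<omega>] by blast
  have le: "level_density D k \<gamma> \<le> \<mu> ^ k" for k by (simp add: level_density_def \<mu>_def)
  have em: "emeasure (level_measure D N) \<omega> = ennreal (level_density D (min n N) \<gamma> / m ^ n)"
    using level_measure_atom_le[OF D _ \<omega> \<gamma>, of N] level_measure_atom_ge[OF _ \<omega> \<gamma>, of N D]
    by (cases "n \<le> N") (auto simp: min_def m_def)
  have "level_density D (min n N) \<gamma> \<le> \<mu> ^ n"
    using le[of "min n N"] power_increasing[of "min n N" n \<mu>] \<mu> by simp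
  then have "(m / \<mu>) ^ n * (level_density D (min n N) \<gamma> / m ^ n) \<le> (m / \<mu>) ^ n * (\<mu> ^ n / m ^ n)"
    using m \<mu> by (intro mult_left_mono divide_right_mono) auto
  also have "\<dots> = 1" using m \<mu> by (simp add: power_divide)
  finally have "(m / \<mu>) ^ n * (level_density D (min n N) \<gamma> / m ^ n) \<le> 1" .
  then show "ennreal ((real CARD('mu mod_ring ^ 'd) / real CARD('mu)) ^ n) * emeasure (level_measure D N) \<omega> \<le> 1"
    unfolding em m_def[symmetric] \<mu>_def[symmetric]
    using m \<mu> by (simp flip: ennreal_mult)
qed

text \<open>Along a path that stays in the level sets, every step contributes the same amount: the factor
  \<open>m\<^sup>-\<^sup>n\<^sup>/\<^sup>d = \<mu>\<^sup>-\<^sup>n\<close> compensates for the size \<open>\<mu>\<^sup>n\<close> of the martingale.\<close>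

lemma frac_integral_level_martingale:
  fixes K :: "'mu::nontriv mod_ring ^ 'd::finite \<Rightarrow> complex ^ 'd"
  assumes K0: "(\<Sum>x\<in>UNIV. K x) = 0" and \<gamma>: "\<forall>i<N. level D (\<gamma> i) = 0"
  shows "frac_integral (1 / real CARD('d)) (conv_op K) (level_martingale D N) \<gamma>
     = of_real (real N * real CARD('mu)) * (\<Sum>z | level D z = 0. pairing (K z) (\<Sum>j\<in>D. axis j 1))"
proof -
  define c where "c = (\<Sum>z | level D z = 0. pairing (K z) (\<Sum>j\<in>D. axis j 1))"
  define e where "e = (\<Sum>j\<in>D. axis j 1 :: complex ^ 'd)"
  define \<mu> where "\<mu> = real CARD('mu)"
  have \<mu>: "\<mu> > 0" by (simp add: \<mu>_def)
  have smult_of_real: "of_real r *s e = r *\<^sub>R e" for r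
    unfolding vec_eq_iff vector_scaleR_component vector_smult_component by (simp add: scaleR_conv_of_real)
  let ?g = "\<lambda>n. mart_diff (level_martingale D N) n"
  have stat: "level_martingale D N n = level_martingale D N N" if "n \<ge> N" for n
    using that by (simp add: level_martingale_def fun_eq_iff min_def)
  have "frac_integral (1 / real CARD('d)) (conv_op K) (level_martingale D N) \<gamma>
     = (\<Sum>n<N. of_real (1 / \<mu> ^ n) *
        (\<Sum>\<omega>\<in>atoms n. \<Sum>x\<in>UNIV. conv_op K (?g n \<omega>) x * indicator (kid n \<omega> x) \<gamma>))"
  proof -
    have "frac_integral (1 / real CARD('d)) (conv_op K) (level_martingale D N) \<gamma>
       = (\<Sum>n<N. of_real (real CARD('mu mod_ring ^ 'd) powr (- (1 / real CARD('d)) * real n)) *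
          (\<Sum>\<omega>\<in>atoms n. \<Sum>x\<in>UNIV. conv_op K (?g n \<omega>) x * indicator (kid n \<omega> x) \<gamma>))"
      by (rule frac_integral_eq_sum[where \<phi> = "conv_op K"], erule stat, rule conv_op_zero)
    then show ?thesis unfolding powr_card_vec(1) \<mu>_def .
  qed
  also have "\<dots> = (\<Sum>n<N. of_real \<mu> * c)"
  proof (rule sum.cong[OF refl])
    fix n assume "n \<in> {..<N}"
    then have n: "n < N" by simp
    have "(\<Sum>\<omega>\<in>atoms n. \<Sum>x\<in>UNIV. conv_op K (?g n \<omega>) x * indicator (kid n \<omega> x) \<gamma>)
        = (\<Sum>\<omega>\<in>atoms n. conv_op K (?g n \<omega>) (\<gamma> n) * indicator \<omega> \<gamma>)"
    proof (rule sum.cong[OF refl])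
      fix \<omega>
      have "(\<Sum>x\<in>UNIV. conv_op K (?g n \<omega>) x * indicator (kid n \<omega> x) \<gamma>)
          = (\<Sum>x\<in>UNIV. if \<gamma> n = x then conv_op K (?g n \<omega>) x * indicator \<omega> \<gamma> else 0)"
        by (rule sum.cong) (auto simp: kid_def indicator_def)
      then show "(\<Sum>x\<in>UNIV. conv_op K (?g n \<omega>) x * indicator (kid n \<omega> x) \<gamma>)
          = conv_op K (?g n \<omega>) (\<gamma> n) * indicator \<omega> \<gamma>" by simp
    qed
    also have "\<dots> = conv_op K (?g n (cylinder n \<gamma>)) (\<gamma> n)"
      by (rule sum_atoms_indicator)
    also have "?g n (cylinder n \<gamma>)
        = (\<lambda>x. - (\<mu> ^ n *\<^sub>R e) + (if level D x = 0 then of_real (\<mu> ^ Suc n) *s e else 0))"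
    proof
      fix x
      have "level_density D n \<gamma> = \<mu> ^ n" using \<gamma> n by (simp add: level_density_def \<mu>_def)
      then show "?g n (cylinder n \<gamma>) x = - (\<mu> ^ n *\<^sub>R e) + (if level D x = 0 then of_real (\<mu> ^ Suc n) *s e else 0)"
        unfolding mart_diff_level_martingale[OF n] \<mu>_def[symmetric] e_def[symmetric]
        unfolding smult_of_real by (simp add: algebra_simps)
    qed
    also have "conv_op K \<dots> (\<gamma> n) = of_real (\<mu> ^ Suc n) * c"
      unfolding conv_op_add_const[OF K0] c_def e_def
      using \<gamma> n by (intro conv_op_level_set) simp
    finally show "of_real (1 / \<mu> ^ n) * (\<Sum>\<omega>\<in>atoms n. \<Sum>x\<in>UNIV. conv_op K (?g n \<omega>) x * indicator (kid n \<omega> x) \<gamma>)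
       = of_real \<mu> * c" using \<mu> by simp
  qed
  finally show ?thesis by (simp add: c_def \<mu>_def)
qed

text \<open>Testing on the level martingale and the level measure stopped at \<open>N\<close> bounds \<open>N \<mu> |c|\<close> by a constant,
  where \<open>c\<close> is the sum in question.\<close>

lemma inequality_imp_cancellation:
  fixes K :: "'mu::nontriv mod_ring ^ 'd::finite \<Rightarrow> complex ^ 'd" and C :: real
  assumes K0: "(\<Sum>x\<in>UNIV. K x) = 0"
    and ineq: "\<And>F \<nu>. F \<in> mart_space W_nabla \<Longrightarrow> simple_martingale F \<Longrightarrow>
            sets \<nu> = sets tree_borel \<Longrightarrow> finite_measure \<nu> \<Longrightarrow>
            growth_const (1 / real CARD('d)) \<nu> < \<infinity> \<Longrightarrow>
            (\<integral>\<^sup>+\<gamma>. ennreal (norm (frac_integral (1 / real CARD('d)) (conv_op K) F \<gamma>)) \<partial>\<nu>)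
              \<le> ennreal C * growth_const (1 / real CARD('d)) \<nu> * L1_norm F"
  shows "(\<Sum>z | level D z = 0. pairing (K z) (\<Sum>j\<in>D. axis j 1)) = 0"
proof (rule ccontr)
  define c where "c = (\<Sum>z | level D z = 0. pairing (K z) (\<Sum>j\<in>D. axis j 1))"
  define e where "e = (\<Sum>j\<in>D. axis j 1 :: complex ^ 'd)"
  define \<mu> where "\<mu> = real CARD('mu)"
  have \<mu>: "\<mu> > 0" by (simp add: \<mu>_def)
  assume "\<not> ?thesis"
  then have c: "c \<noteq> 0" by (simp add: c_def)
  have D: "D \<noteq> {}"
  proof
    assume "D = {}"
    then show False using c by (simp add: c_def)
  qed
  \<comment> \<open>Here \<open>C\<close> may be negative, in which case \<open>ennreal C = 0\<close>.\<close>
  have bound: "real N * \<mu> * norm c \<le> max C 0 * norm e" for N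
  proof -
    define F where "F = (level_martingale D N :: nat \<Rightarrow> (nat \<Rightarrow> 'mu mod_ring ^ 'd) \<Rightarrow> complex ^ 'd)"
    define \<nu> where "\<nu> = (level_measure D N :: (nat \<Rightarrow> 'mu mod_ring ^ 'd) measure)"
    define H where "H = {\<gamma> :: nat \<Rightarrow> 'mu mod_ring ^ 'd. \<forall>i<N. level D (\<gamma> i) = 0}"
    interpret P: prob_space \<nu> unfolding \<nu>_def by (rule prob_space_level_measure[OF D])
    have meas: "(\<lambda>\<gamma>. ennreal (level_density D N \<gamma>)) \<in> borel_measurable (tree_prob :: (nat \<Rightarrow> 'mu mod_ring ^ 'd) measure)"
      by (intro measurable_compose[OF _ measurable_ennreal]
          depends_on_digits_measurable_tree_prob[OF depends_on_digits_level_density])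
    have "depends_on_digits N (\<lambda>\<gamma>. \<gamma> \<in> H)" by (simp add: depends_on_digits_def H_def)
    from depends_on_digits_vimage[OF this, of "{True}"]
    have H: "H \<in> sets (tree_prob :: (nat \<Rightarrow> 'mu mod_ring ^ 'd) measure)"
      using sets_tree_filtration_subset[of N] by (auto simp: sets_tree_prob vimage_def)
    have "emeasure \<nu> H = (\<integral>\<^sup>+\<gamma>. ennreal (level_density D N \<gamma>) * indicator H \<gamma> \<partial>tree_prob)"
      unfolding \<nu>_def level_measure_def by (rule emeasure_density[OF meas H])
    also have "\<dots> = (\<integral>\<^sup>+\<gamma>. ennreal (level_density D N \<gamma>) \<partial>(tree_prob :: (nat \<Rightarrow> 'mu mod_ring ^ 'd) measure))"
      by (rule nn_integral_cong) (simp add: H_def level_density_def)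
    also have "\<dots> = 1" by (rule nn_integral_level_density[OF D])
    finally have \<nu>H: "emeasure \<nu> H = 1" .
    have "ennreal (real N * \<mu> * norm c) = (\<integral>\<^sup>+\<gamma>. ennreal (real N * \<mu> * norm c) * indicator H \<gamma> \<partial>\<nu>)"
      using H \<nu>H by (simp add: nn_integral_cmult_indicator \<nu>_def sets_level_measure sets_tree_prob)
    also have "\<dots> \<le> (\<integral>\<^sup>+\<gamma>. ennreal (norm (frac_integral (1 / real CARD('d)) (conv_op K) F \<gamma>)) \<partial>\<nu>)"
    proof (rule nn_integral_mono)
      fix \<gamma>
      show "ennreal (real N * \<mu> * norm c) * indicator H \<gamma>
        \<le> ennreal (norm (frac_integral (1 / real CARD('d)) (conv_op K) F \<gamma>))"
      proof (cases "\<gamma> \<in> H")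
        case True
        then have "\<forall>i<N. level D (\<gamma> i) = 0" by (simp add: H_def)
        from frac_integral_level_martingale[OF K0 this]
        show ?thesis using True unfolding F_def \<mu>_def c_def by (simp add: norm_mult)
      qed simp
    qed
    also have "\<dots> \<le> ennreal C * growth_const (1 / real CARD('d)) \<nu> * L1_norm F"
    proof (rule ineq)
      show "F \<in> mart_space W_nabla" unfolding F_def by (rule level_martingale_in_mart_space[OF D])
      show "simple_martingale F"
        unfolding simple_martingale_def F_def
        by (intro exI[of _ N]) (simp add: level_martingale_def fun_eq_iff min_def)
      show "sets \<nu> = sets tree_borel" by (simp add: \<nu>_def sets_level_measure)
      show "finite_measure \<nu>" by (rule P.finite_measure_axioms)
      show "growth_const (1 / real CARD('d)) \<nu> < \<infinity>"
        using growth_const_level_measure_le[OF D, of N, where 'mu = 'mu] unfolding \<nu>_def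
        by (rule order_le_less_trans) simp
    qed
    also have "\<dots> \<le> ennreal (max C 0) * 1 * ennreal (norm e)"
      unfolding F_def \<nu>_def L1_norm_level_martingale[OF D] e_def
      by (intro mult_mono growth_const_level_measure_le[OF D] ennreal_leI) auto
    also have "\<dots> = ennreal (max C 0 * norm e)" by (simp only: mult_1_right) (rule ennreal_mult[symmetric], auto)
    finally show ?thesis by (subst (asm) ennreal_le_iff) simp_all
  qed
  have "\<mu> * norm c > 0" using \<mu> c by simp
  then obtain N where "max C 0 * norm e < real N * (\<mu> * norm c)"
    using reals_Archimedean3 by blast
  with bound[of N] show False by (simp add: mult.assoc)
qed

theorem theorem7p1:
  fixes K :: "'mu::nontriv mod_ring ^ 'd::finite \<Rightarrow> complex ^ 'd"
  assumes "CARD('d) \<ge> 2"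
    and "(\<Sum>x\<in>UNIV. K x) = 0"
  shows "(\<exists>C::real. \<forall>F \<nu>.
            F \<in> mart_space W_nabla \<and> simple_martingale F \<and>
            sets \<nu> = sets tree_borel \<and> finite_measure \<nu> \<and>
            growth_const (1 / real CARD('d)) \<nu> < \<infinity> \<longrightarrow>
            (\<integral>\<^sup>+\<gamma>. ennreal (norm (frac_integral (1 / real CARD('d)) (conv_op K) F \<gamma>)) \<partial>\<nu>)
              \<le> ennreal C * growth_const (1 / real CARD('d)) \<nu> * L1_norm F)
         \<longleftrightarrow>
         (\<forall>D :: 'd set.
            (\<Sum>x | (\<Sum>j\<in>D. x $ j) = 0. pairing (K x) (\<Sum>j\<in>D. axis j 1)) = 0)"
    (is "?ineq \<longleftrightarrow> ?cancel")
proof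
  assume ?ineq
  then obtain C where C: "\<And>F \<nu>. F \<in> mart_space W_nabla \<Longrightarrow> simple_martingale F \<Longrightarrow>
            sets \<nu> = sets tree_borel \<Longrightarrow> finite_measure \<nu> \<Longrightarrow>
            growth_const (1 / real CARD('d)) \<nu> < \<infinity> \<Longrightarrow>
            (\<integral>\<^sup>+\<gamma>. ennreal (norm (frac_integral (1 / real CARD('d)) (conv_op K) F \<gamma>)) \<partial>\<nu>)
              \<le> ennreal C * growth_const (1 / real CARD('d)) \<nu> * L1_norm F"
    by blast
  show ?cancel
    using inequality_imp_cancellation[OF assms(2) C] unfolding level_def by blast
next
  assume ?cancel
  then have "(\<Sum>z | level D z = 0. pairing (K z) (\<Sum>j\<in>D. axis j 1)) = 0" for D
    by (simp add: level_def)
  then show ?ineq by (rule cancellation_imp_inequality[OF assms(2)])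
qed

end
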